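(* Let $\mathbb{K}\in\{\mathbb{R},\mathbb{C}\}$ and let $V$ be a finite-dimensional $\mathbb{K}$-vector space with $\dim V\ge3$. Let $\mathfrak{r}$ range over the minimal right ideals of $\mathbb{K}[\mathcal{S}_3]$ that belong to the partition $(2\,1)\vdash 3$ and are different from $\mathfrak{r}_0=f_0\cdot\mathbb{K}[\mathcal{S}_3]$, where $f_0=\frac12\{\mathrm{id}-(1\,3)\}-\frac16\sum_{p\in\mathcal{S}_3}\mathrm{sign}(p)\,p$. Let $y_t$, $y_{t'}$ be the Young symmetrizers of the tableaux $t$ with rows $(1,3),(2,4)$ and $t'$ with rows $(1,3,5),(2,4)$. Let $\ell_w(\mathfrak{r})$, $\ell_S(\mathfrak{r})$, $\ell_A(\mathfrak{r})$ denote the lengths (as defined in the context) of the reduced coordinate expressions of $y_t^{\ast}(U\otimes w)$, $y_{t'}^{\ast}(U\otimes S)$, $y_{t'}^{\ast}(U\otimes A)$ for $U\in\mathcal{T}_{\mathfrak{r}}$, $w\in\mathcal{T}_1V$, $S\in\mathcal{S}^2(V)$, $A\in\Lambda^2(V)$. Then: (1) (a) For generic $\mathfrak{r}$ (all but finitely many), $\ell_w(\mathfrak{r})=8$, $\ell_S(\mathfrak{r})=16$, $\ell_A(\mathfrak{r})=20$. (b) The minimal values over all such $\mathfrak{r}$ are $\min\ell_w=4$, $\min\ell_S=12$, $\min\ell_A=10$. (2) There exist exactly 2 such right ideals $\mathfrak{r}\ne\mathfrak{r}_0$ for which all three minimal lengths are attained, i.e. $\ell_w(\mathfrak{r})=4$,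 $\ell_S(\mathfrak{r})=12$ and $\ell_A(\mathfrak{r})=10$. (3) If $\mathfrak{r}$ attains one of the minimal lengths in (1)(b), i.e. $\ell_w(\mathfrak{r})=4$ or $\ell_S(\mathfrak{r})=12$ or $\ell_A(\mathfrak{r})=10$, then the tensors $U\in\mathcal{T}_{\mathfrak{r}}$ admit an index commutation symmetry.
   Context: $\mathcal{T}_rV$ is the space of $r$-times covariant tensors on $V$; $\mathcal{S}^2(V)$, $\Lambda^2(V)\subset\mathcal{T}_2V$ are the symmetric, resp. alternating, 2-forms. A group ring element $a=\sum_{p}a(p)\,p\in\mathbb{K}[\mathcal{S}_r]$ acts on $T\in\mathcal{T}_rV$ by $(aT)_{i_1\dots i_r}=\sum_p a(p)T_{i_{p(1)}\dots i_{p(r)}}$. Products of permutations are $(p\circ q)(i)=p(q(i))$, and $a^{\ast}:=\sum_p a(p)\,p^{-1}$. The Young symmetrizer of a tableau $t$ is $y_t=\sum_{p\in\mathcal{H}_t}\sum_{q\in\mathcal{V}_t}\mathrm{sign}(q)\,p\circ q$, where $\mathcal{H}_t$, $\mathcal{V}_t$ are the groups of permutations that permute numbers only within the rows, resp. columns, of $t$. The symmetry class of a right ideal $\mathfrak{r}\subseteq\mathbb{K}[\mathcal{S}_r]$ is $\mathcal{T}_{\mathfrak{r}}=\{aT\,|\,a\in\mathfrak{r},\,T\in\mathcal{T}_rV\}$. A minimal right ideal belongs to $\lambda\vdash r$ if it lies in the minimal two-sided ideal of $\mathbb{K}[\mathcal{S}_r]$ corresponding to $\lambda$, i.e. the one containing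 the Young symmetrizers of all tableaux of frame $\lambda$. Lengths. Let $\mathfrak{r}\subset\mathbb{K}[\mathcal{S}_3]$ be a minimal right ideal belonging to $(2\,1)$; it has dimension 2. The linear identities $\sum_{p\in\mathcal{S}_3}x_p\,U_{i_{p(1)}i_{p(2)}i_{p(3)}}=0$ valid for all $U\in\mathcal{T}_{\mathfrak{r}}$ are exactly the solutions $x\in\mathbb{K}^{\mathcal{S}_3}$ of $\sum_p h(p)x_p=0$ for all $h\in\mathfrak{l}:=\mathfrak{r}^{\ast}=\{a^{\ast}\,|\,a\in\mathfrak{r}\}$. A 2-element subset $\mathcal{P}\subset\mathcal{S}_3$ is called admissible for $\mathfrak{r}$ if, for a basis $h_1,h_2$ of $\mathfrak{l}$, the $2\times2$ determinant $\det(h_i(p))_{i\in\{1,2\},\,p\in\mathcal{P}}$ is nonzero. Then for each $\bar p\in\mathcal{S}_3\setminus\mathcal{P}$ there is a unique such identity expressing $U_{i_{\bar p(1)}i_{\bar p(2)}i_{\bar p(3)}}$ as a linear combination of the two coordinates $U_{i_{p(1)}i_{p(2)}i_{p(3)}}$, $p\in\mathcal{P}$. Reduction with respect to an admissible $\mathcal{P}$: write the coordinates of the tensor as a formal polynomial in ordered index names $i_1<i_2<i_3<i_4$ (resp. $i_1<\dots<i_5$), namely $y_t^{\ast}(U\otimes w)_{i_1\dots i_4}=\sum_{p\in\mathcal{S}_4}c_p\,U_{i_{p(1)}i_{p(2)}i_{p(3)}}w_{i_{p(4)}}$, resp. $y_{t'}^{\ast}(U\otimes S)_{i_1\dots i_5}$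 or $y_{t'}^{\ast}(U\otimes A)_{i_1\dots i_5}=\sum_{p\in\mathcal{S}_5}c_p\,U_{i_{p(1)}i_{p(2)}i_{p(3)}}B_{i_{p(4)}i_{p(5)}}$ with $B=S$ or $B=A$; in the latter two cases use $S_{ab}=S_{ba}$, resp. $A_{ab}=-A_{ba}$, to put the indices of $S$, $A$ into increasing order. In every term regard the three indices of $U$ as a permutation of their increasingly ordered sequence $a_1<a_2<a_3$, and replace every $U_{a_{\bar p(1)}a_{\bar p(2)}a_{\bar p(3)}}$ with $\bar p\notin\mathcal{P}$ by its expression in the $U_{a_{p(1)}a_{p(2)}a_{p(3)}}$, $p\in\mathcal{P}$. Collect like monomials; the length of the result is the number of monomials with nonzero coefficient. The length $\ell_w(\mathfrak{r})$, $\ell_S(\mathfrak{r})$, $\ell_A(\mathfrak{r})$ is the smallest length so obtained over all sets $\mathcal{P}$ admissible for $\mathfrak{r}$. Index commutation symmetry: the tensors $U\in\mathcal{T}_{\mathfrak{r}}$ admit an index commutation symmetry if there are a permutation $p\in\mathcal{S}_3$, $p\ne\mathrm{id}$, and a scalar $\varepsilon\in\mathbb{K}$ (a root of unity) such that $U_{i_{p(1)}i_{p(2)}i_{p(3)}}=\varepsilon\,U_{i_1i_2i_3}$ for all $U\in\mathcal{T}_{\mathfrak{r}}$. *)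

theory Defs
  imports Complex_Main "HOL-Combinatorics.Permutations"
begin

section \<open>The group ring of the symmetric group\<close>

text \<open>The elements of the symmetric group of degree r are the functions p with
  p permutes {1..r}; the product of p and q is p o q.  An element of the group ring is
  represented by its coefficient function, which vanishes outside the group.\<close>

type_synonym 'k group_ring_elt = "(nat \<Rightarrow> nat) \<Rightarrow> 'k"

definition group_ring :: "nat \<Rightarrow> ('k::field) group_ring_elt set" where
  "group_ring r = {a. \<forall>p. \<not> p permutes {1..r} \<longrightarrow> a p = 0}"

definition gr_mult :: "nat \<Rightarrow> ('k::field) group_ring_elt \<Rightarrow> 'k group_ring_elt \<Rightarrow> 'k group_ring_elt" where
  "gr_mult r a b = (\<lambda>s. \<Sum>p | p permutes {1..r}. \<Sum>q | q permutes {1..r}.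
     if p \<circ> q = s then a p * b q else 0)"

text \<open>The test for bijectivity is needed because \<open>inv s\<close> is unspecified, and may even
  be a permutation, when s is not bijective.\<close>

definition star :: "('k::field) group_ring_elt \<Rightarrow> 'k group_ring_elt" where
  "star a = (\<lambda>s. if bij s then a (inv s) else 0)"

text \<open>Closure under scalars is implied by closure under multiplication with multiples
  of the identity permutation.\<close>

definition right_ideal :: "nat \<Rightarrow> ('k::field) group_ring_elt set \<Rightarrow> bool" where
  "right_ideal r J \<longleftrightarrow> J \<subseteq> group_ring r \<and> (\<lambda>_. 0) \<in> J \<and>
     (\<forall>a\<in>J. \<forall>b\<in>J. (\<lambda>p. a p + b p) \<in> J) \<and>
     (\<forall>a\<in>J. \<forall>b\<in>group_ring r. gr_mult r a b \<in> J)"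

definition two_sided_ideal :: "nat \<Rightarrow> ('k::field) group_ring_elt set \<Rightarrow> bool" where
  "two_sided_ideal r J \<longleftrightarrow> right_ideal r J \<and>
     (\<forall>a\<in>J. \<forall>b\<in>group_ring r. gr_mult r b a \<in> J)"

definition minimal_right_ideal :: "nat \<Rightarrow> ('k::field) group_ring_elt set \<Rightarrow> bool" where
  "minimal_right_ideal r J \<longleftrightarrow> right_ideal r J \<and> J \<noteq> {\<lambda>_. 0} \<and>
     (\<forall>J'. right_ideal r J' \<and> J' \<subseteq> J \<longrightarrow> J' = {\<lambda>_. 0} \<or> J' = J)"

definition minimal_two_sided_ideal :: "nat \<Rightarrow> ('k::field) group_ring_elt set \<Rightarrow> bool" where
  "minimal_two_sided_ideal r J \<longleftrightarrow> two_sided_ideal r J \<and> J \<noteq> {\<lambda>_. 0} \<and>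
     (\<forall>J'. two_sided_ideal r J' \<and> J' \<subseteq> J \<longrightarrow> J' = {\<lambda>_. 0} \<or> J' = J)"

definition principal_right_ideal :: "nat \<Rightarrow> ('k::field) group_ring_elt \<Rightarrow> 'k group_ring_elt set" where
  "principal_right_ideal r a = gr_mult r a ` group_ring r"

section \<open>Tableaux and Young symmetrizers\<close>

text \<open>A tableau is the list of its rows.\<close>

definition tableau_of_frame :: "nat list \<Rightarrow> nat list list \<Rightarrow> bool" where
  "tableau_of_frame lam t \<longleftrightarrow>
     map length t = lam \<and> distinct (concat t) \<and> set (concat t) = {1..sum_list lam}"

definition column :: "nat list list \<Rightarrow> nat \<Rightarrow> nat set" where
  "column t j = {t ! i ! j | i. i < length t \<and> j < length (t ! i)}"

definition row_group :: "nat list list \<Rightarrow> (nat \<Rightarrow> nat) set" where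
  "row_group t = {p. p permutes set (concat t) \<and> (\<forall>row\<in>set t. p ` set row = set row)}"

definition column_group :: "nat list list \<Rightarrow> (nat \<Rightarrow> nat) set" where
  "column_group t = {p. p permutes set (concat t) \<and> (\<forall>j. p ` column t j = column t j)}"

definition young_symmetrizer :: "nat list list \<Rightarrow> ('k::field) group_ring_elt" where
  "young_symmetrizer t = (\<lambda>s. \<Sum>p\<in>row_group t. \<Sum>q\<in>column_group t.
     if p \<circ> q = s then of_int (sign q) else 0)"

definition belongs_to_partition :: "nat list \<Rightarrow> ('k::field) group_ring_elt set \<Rightarrow> bool" where
  "belongs_to_partition lam J \<longleftrightarrow> (\<exists>I. minimal_two_sided_ideal (sum_list lam) I \<and>
     (\<forall>t. tableau_of_frame lam t \<longrightarrow> young_symmetrizer t \<in> I) \<and> J \<subseteq> I)"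

section \<open>Tensors and symmetry classes\<close>

text \<open>An r-times covariant tensor is an r-linear form.  Its argument tuple is a function v
  on the naturals of which only v 1, ..., v r matter.  The coordinate with indices
  i(1), ..., i(r) is the value at the corresponding basis vectors, so an identity between
  \<open>v \<circ> p\<close> and \<open>v \<circ> q\<close> for all v is by multilinearity the same as the identity between
  the index permutations p and q of the coordinates.\<close>

definition tensors :: "('k::field \<Rightarrow> 'v \<Rightarrow> 'v) \<Rightarrow> nat \<Rightarrow> ((nat \<Rightarrow> 'v::ab_group_add) \<Rightarrow> 'k) set" where
  "tensors scale r = {T.
     (\<forall>v v'. (\<forall>i\<in>{1..r}. v i = v' i) \<longrightarrow> T v = T v') \<and>
     (\<forall>i\<in>{1..r}. \<forall>v. Vector_Spaces.linear scale (*) (\<lambda>x. T (v(i := x))))}"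

definition gr_act :: "nat \<Rightarrow> ('k::field) group_ring_elt \<Rightarrow> ((nat \<Rightarrow> 'v) \<Rightarrow> 'k) \<Rightarrow> (nat \<Rightarrow> 'v) \<Rightarrow> 'k" where
  "gr_act r a T = (\<lambda>v. \<Sum>p | p permutes {1..r}. a p * T (v \<circ> p))"

definition symmetry_class ::
  "('k::field \<Rightarrow> 'v \<Rightarrow> 'v) \<Rightarrow> nat \<Rightarrow> 'k group_ring_elt set \<Rightarrow> ((nat \<Rightarrow> 'v::ab_group_add) \<Rightarrow> 'k) set" where
  "symmetry_class scale r J = {gr_act r a T | a T. a \<in> J \<and> T \<in> tensors scale r}"

definition index_commutation_symmetry ::
  "('k::field \<Rightarrow> 'v::ab_group_add \<Rightarrow> 'v) \<Rightarrow> 'k group_ring_elt set \<Rightarrow> bool" where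
  "index_commutation_symmetry scale J \<longleftrightarrow>
     (\<exists>p \<epsilon>. p permutes {1..3} \<and> p \<noteq> id \<and> (\<exists>m>0. \<epsilon> ^ m = 1) \<and>
       (\<forall>U\<in>symmetry_class scale 3 J. \<forall>v. U (v \<circ> p) = \<epsilon> * U v))"

section \<open>Reduction and lengths\<close>

definition is_basis2 ::
  "('k::field) group_ring_elt set \<Rightarrow> 'k group_ring_elt \<Rightarrow> 'k group_ring_elt \<Rightarrow> bool" where
  "is_basis2 L h1 h2 \<longleftrightarrow> L = {\<lambda>p. c1 * h1 p + c2 * h2 p | c1 c2. True} \<and>
     (\<forall>c1 c2. (\<forall>p. c1 * h1 p + c2 * h2 p = 0) \<longrightarrow> c1 = 0 \<and> c2 = 0)"

definition admissible :: "('k::field) group_ring_elt set \<Rightarrow> (nat \<Rightarrow> nat) set \<Rightarrow> bool" where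
  "admissible J P \<longleftrightarrow> (\<exists>p1 p2 h1 h2. P = {p1, p2} \<and> p1 \<noteq> p2 \<and>
     p1 permutes {1..3} \<and> p2 permutes {1..3} \<and>
     is_basis2 (star ` J) h1 h2 \<and> h1 p1 * h2 p2 - h1 p2 * h2 p1 \<noteq> 0)"

text \<open>The coefficients of the unique linear identity, valid on the symmetry class, that
  expresses the coordinate of U permuted by pb in terms of those permuted by the elements of P.\<close>

definition reduction_coeff ::
  "('k::field \<Rightarrow> 'v::ab_group_add \<Rightarrow> 'v) \<Rightarrow> 'k group_ring_elt set \<Rightarrow>
   (nat \<Rightarrow> nat) set \<Rightarrow> (nat \<Rightarrow> nat) \<Rightarrow> (nat \<Rightarrow> nat) \<Rightarrow> 'k" where
  "reduction_coeff scale J P pb =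
     (if pb \<in> P then (\<lambda>q. if q = pb then 1 else 0)
      else (THE c. (\<forall>q. q \<notin> P \<longrightarrow> c q = 0) \<and>
        (\<forall>U\<in>symmetry_class scale 3 J. \<forall>v. U (v \<circ> pb) = (\<Sum>q\<in>P. c q * U (v \<circ> q)))))"

text \<open>The permutation pb of {1..3} with p i = a (pb i) for i in {1..3}, where a 1 < a 2 < a 3
  are the elements of p ` {1..3}.\<close>

definition pattern3 :: "(nat \<Rightarrow> nat) \<Rightarrow> nat \<Rightarrow> nat" where
  "pattern3 p = (\<lambda>i. if i \<in> {1..3} then card {j \<in> {1..3}. p j \<le> p i} else i)"

text \<open>A monomial is the pair of the index list of U and the index list of the second factor
  (w, S or A), the latter in increasing order.  Index names are represented by their numbers.\<close>

definition monomial :: "nat \<Rightarrow> (nat \<Rightarrow> nat) \<Rightarrow> (nat \<Rightarrow> nat) \<Rightarrow> nat list \<times> nat list" where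
  "monomial n p q =
     (map (\<lambda>k. sorted_list_of_set (p ` {1..3}) ! (q k - 1)) [1, 2, 3],
      sort (map p [4..<Suc n]))"

text \<open>The reduced polynomial, as a function from monomials to coefficients, obtained from the
  sum over all p of \<open>c p\<close> times U with indices p 1, p 2, p 3 times B with indices p 4, ..., p n.
  Here B has one or two indices (n is 4 or 5), and \<open>\<sigma>\<close> is the factor by which B changes
  when its two indices are exchanged.\<close>

definition reduced_polynomial ::
  "('k::field \<Rightarrow> 'v::ab_group_add \<Rightarrow> 'v) \<Rightarrow> nat \<Rightarrow> 'k \<Rightarrow> 'k group_ring_elt \<Rightarrow>
   'k group_ring_elt set \<Rightarrow> (nat \<Rightarrow> nat) set \<Rightarrow> nat list \<times> nat list \<Rightarrow> 'k" where
  "reduced_polynomial scale n \<sigma> c J P = (\<lambda>m.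
     \<Sum>p | p permutes {1..n}. \<Sum>q\<in>P.
       if monomial n p q = m
       then c p * (if sorted (map p [4..<Suc n]) then 1 else \<sigma>) *
            reduction_coeff scale J P (pattern3 p) q
       else 0)"

definition reduced_length ::
  "('k::field \<Rightarrow> 'v::ab_group_add \<Rightarrow> 'v) \<Rightarrow> nat \<Rightarrow> 'k \<Rightarrow> 'k group_ring_elt \<Rightarrow>
   'k group_ring_elt set \<Rightarrow> nat" where
  "reduced_length scale n \<sigma> c J =
     (LEAST l. \<exists>P. admissible J P \<and> l = card {m. reduced_polynomial scale n \<sigma> c J P m \<noteq> 0})"

definition length_w :: "('k::field \<Rightarrow> 'v::ab_group_add \<Rightarrow> 'v) \<Rightarrow> nat list list \<Rightarrow> 'k group_ring_elt set \<Rightarrow> nat" where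
  "length_w scale t = reduced_length scale 4 1 (star (young_symmetrizer t))"

definition length_S :: "('k::field \<Rightarrow> 'v::ab_group_add \<Rightarrow> 'v) \<Rightarrow> nat list list \<Rightarrow> 'k group_ring_elt set \<Rightarrow> nat" where
  "length_S scale t = reduced_length scale 5 1 (star (young_symmetrizer t))"

definition length_A :: "('k::field \<Rightarrow> 'v::ab_group_add \<Rightarrow> 'v) \<Rightarrow> nat list list \<Rightarrow> 'k group_ring_elt set \<Rightarrow> nat" where
  "length_A scale t = reduced_length scale 5 (-1) (star (young_symmetrizer t))"

definition f0 :: "('k::field) group_ring_elt" where
  "f0 = (\<lambda>s. 1/2 * ((if s = id then 1 else 0) - (if s = transpose 1 3 then 1 else 0))
           - 1/6 * (if s permutes {1..3} then of_int (sign s) else 0))"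

definition field_iso :: "('a::field \<Rightarrow> 'b::field) \<Rightarrow> bool" where
  "field_iso \<phi> \<longleftrightarrow> bij \<phi> \<and> (\<forall>x y. \<phi> (x + y) = \<phi> x + \<phi> y) \<and> (\<forall>x y. \<phi> (x * y) = \<phi> x * \<phi> y)"

end

theory Submission
  imports Defs
begin

text \<open>The minimal right ideals in the block of (2 1) correspond to the lines in the two-dimensional
  standard representation W of the symmetric group of degree 3, realised on vectors (x, y, -x-y): for
  a spanning vector w, the functions in the dual left ideal are the s \<mapsto> \<phi>(s w) with \<phi> a linear form
  on W.  The line of (1, 0, -1) is the excluded ideal, so all others have a unique generator with
  y = 1.  By Cramer's rule, reducing with respect to {p, q} means expanding vectors of W in the basis
  p w, q w, and the coefficient of a monomial is, up to a nonzero factor, a determinant of a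
  combination of the s w against q w or p w.  Hence the length for {p, q} is N(p) + N(q), where N(q)
  counts the index sets D of U whose combination is not parallel to q w.  Up to scalars, only three
  combinations occur for all the D, and their determinants vanish only for x = 0, -1, 1, -2, -1/2;
  in these five cases w is an eigenvector of a transposition.\<close>

section \<open>Group ring and permutations of three letters\<close>

text \<open>Applied to the vectors s w with w = (x, y, -x-y), the three combinations give 3y (-1, 1,
  0), 3y (0, -1, 1) and y (1, 1, -2): fixed vectors times y. For y = 0, the excluded ideal, the
  expressions therefore vanish altogether; for y = 1 only the position of q w relative to these
  vectors matters. The obstacle is the minimum over admissible pairs: the two smallest values of N
  need not be available together, since the permutations attaining them may yield parallel vectors.
  At x = 0 and x = -1 the alternating case has N = 2 twice, but on a single line, whence 2 + 8; the
  symmetric case reaches 12 in two ways, as 6 + 6 for these x and as 4 + 8 for the other three. A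
  length can be read off only after like monomials are collected, so the expansions are proved for
  an arbitrary function of index set and pattern, and an injectivity argument then rules out
  cancellation between the monomials that remain.\<close>

lemma group_ring_outside: "a \<in> group_ring r \<Longrightarrow> \<not> p permutes {1..r} \<Longrightarrow> a p = 0"
  by (simp add: group_ring_def)

lemma permutes_comp_right_iff: "q permutes A \<Longrightarrow> s \<circ> q permutes A \<longleftrightarrow> s permutes A"
  using permutes_compose[OF permutes_inv, of q A "s \<circ> q"] permutes_compose[of q A s]
  by (auto simp: comp_assoc permutes_inv_o)

lemma permutes_comp_left_iff: "q permutes A \<Longrightarrow> q \<circ> s permutes A \<longleftrightarrow> s permutes A"
  using permutes_compose[OF _ permutes_inv, of "q \<circ> s" A q] permutes_compose[of s A q]
  by (auto simp: comp_assoc[symmetric] permutes_inv_o)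

text \<open>For each q exactly one p satisfies p \<circ> q = s, so the inner sum collapses to a
  single term; that p lies in the group iff s does.\<close>

lemma gr_mult_conv_right:
  fixes a b :: "('k::field) group_ring_elt"
  shows "gr_mult r a b s =
    (if s permutes {1..r} then \<Sum>q | q permutes {1..r}. a (s \<circ> inv q) * b q else 0)"
proof -
  let ?S = "{p. p permutes {1..r}}"
  have fin: "finite ?S" by (simp add: finite_permutations)
  have "gr_mult r a b s = (\<Sum>q\<in>?S. \<Sum>p\<in>?S. if p \<circ> q = s then a p * b q else 0)"
    unfolding gr_mult_def by (rule sum.swap)
  also have "\<dots> = (\<Sum>q\<in>?S. if s permutes {1..r} then a (s \<circ> inv q) * b q else 0)"
  proof (rule sum.cong[OF refl])
    fix q assume "q \<in> ?S"
    hence q: "q permutes {1..r}" by simp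
    have eq: "p \<circ> q = s \<longleftrightarrow> p = s \<circ> inv q" for p
      using q by (metis comp_assoc comp_id permutes_inv_o)
    have "(\<Sum>p\<in>?S. if p \<circ> q = s then a p * b q else 0)
        = (\<Sum>p\<in>?S. if p = s \<circ> inv q then a (s \<circ> inv q) * b q else 0)"
      by (rule sum.cong) (auto simp: eq)
    also have "\<dots> = (if s \<circ> inv q \<in> ?S then a (s \<circ> inv q) * b q else 0)"
      using fin by simp
    also have "s \<circ> inv q \<in> ?S \<longleftrightarrow> s permutes {1..r}"
      using permutes_comp_right_iff[OF permutes_inv[OF q]] by simp
    finally show "(\<Sum>p\<in>?S. if p \<circ> q = s then a p * b q else 0)
        = (if s permutes {1..r} then a (s \<circ> inv q) * b q else 0)" .
  qed
  finally show ?thesis by auto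
qed

lemma gr_mult_conv_left:
  fixes a b :: "('k::field) group_ring_elt"
  shows "gr_mult r b a s =
    (if s permutes {1..r} then \<Sum>q | q permutes {1..r}. b q * a (inv q \<circ> s) else 0)"
proof -
  let ?S = "{p. p permutes {1..r}}"
  have fin: "finite ?S" by (simp add: finite_permutations)
  have "gr_mult r b a s = (\<Sum>q\<in>?S. if s permutes {1..r} then b q * a (inv q \<circ> s) else 0)"
    unfolding gr_mult_def
  proof (rule sum.cong[OF refl])
    fix q assume "q \<in> ?S"
    hence q: "q permutes {1..r}" by simp
    have eq: "q \<circ> p = s \<longleftrightarrow> p = inv q \<circ> s" for p
      using q by (metis comp_assoc id_comp permutes_inv_o)
    have "(\<Sum>p\<in>?S. if q \<circ> p = s then b q * a p else 0)
        = (\<Sum>p\<in>?S. if p = inv q \<circ> s then b q * a (inv q \<circ> s) else 0)"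
      by (rule sum.cong) (auto simp: eq)
    also have "\<dots> = (if inv q \<circ> s \<in> ?S then b q * a (inv q \<circ> s) else 0)"
      using fin by simp
    also have "inv q \<circ> s \<in> ?S \<longleftrightarrow> s permutes {1..r}"
      using permutes_comp_left_iff[OF permutes_inv[OF q]] by simp
    finally show "(\<Sum>p\<in>?S. if q \<circ> p = s then b q * a p else 0)
        = (if s permutes {1..r} then b q * a (inv q \<circ> s) else 0)" .
  qed
  thus ?thesis by auto
qed

section \<open>Ideals as linear spaces closed under translations\<close>

lemma sum_in_if_closed:
  assumes "(\<lambda>_. 0) \<in> J" "\<And>a b. a \<in> J \<Longrightarrow> b \<in> J \<Longrightarrow> (\<lambda>p. a p + b p) \<in> J"
    "finite Q" "\<And>q. q \<in> Q \<Longrightarrow> f q \<in> J"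
  shows "(\<lambda>s. \<Sum>q\<in>Q. f q s) \<in> J"
  using assms(3,4) by (induction Q rule: finite_induct) (use assms(1,2) in auto)

text \<open>Multiplying by a scalar multiple of \<open>inv q\<close> is a scaled right translation,
  and every product is a linear combination of right translates. From here on, ideals are handled
  through translates, without convolution sums.\<close>

lemma right_ideal_iff:
  fixes J :: "('k::field) group_ring_elt set"
  shows "right_ideal r J \<longleftrightarrow> J \<subseteq> group_ring r \<and> (\<lambda>_. 0) \<in> J \<and>
    (\<forall>a\<in>J. \<forall>b\<in>J. (\<lambda>p. a p + b p) \<in> J) \<and> (\<forall>a\<in>J. \<forall>c. (\<lambda>p. c * a p) \<in> J) \<and>
    (\<forall>a\<in>J. \<forall>q. q permutes {1..r} \<longrightarrow> (\<lambda>s. a (s \<circ> q)) \<in> J)" (is "?L \<longleftrightarrow> ?R")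
proof
  assume L: ?L
  have key: "(\<lambda>s. c * a (s \<circ> q)) \<in> J" if a: "a \<in> J" and q: "q permutes {1..r}" for a c q
  proof -
    have aG: "a \<in> group_ring r" using L a by (auto simp: right_ideal_def)
    let ?b = "\<lambda>s. if s = inv q then c else 0"
    have iq: "inv q permutes {1..r}" using q by (rule permutes_inv)
    have "gr_mult r a ?b = (\<lambda>s. c * a (s \<circ> q))"
    proof
      fix s
      have "(\<Sum>p | p permutes {1..r}. a (s \<circ> inv p) * ?b p)
          = (\<Sum>p | p permutes {1..r}. if p = inv q then c * a (s \<circ> q) else 0)"
        by (rule sum.cong) (auto simp: permutes_inv_inv[OF q])
      also have "\<dots> = c * a (s \<circ> q)" using iq by (simp add: finite_permutations)
      finally show "gr_mult r a ?b s = c * a (s \<circ> q)"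
        using group_ring_outside[OF aG] permutes_comp_right_iff[OF q]
        by (simp add: gr_mult_conv_right)
    qed
    moreover have "?b \<in> group_ring r" using iq by (auto simp: group_ring_def)
    ultimately show ?thesis using L a unfolding right_ideal_def by metis
  qed
  show ?R
    using L key[of _ id] key[of _ _ 1] unfolding right_ideal_def by (auto simp: permutes_id)
next
  assume R: ?R
  have "gr_mult r a b \<in> J" if a: "a \<in> J" and b: "b \<in> group_ring r" for a b
  proof -
    have aG: "a \<in> group_ring r" using R a by auto
    have eq: "gr_mult r a b = (\<lambda>s. \<Sum>q | q permutes {1..r}. b q * a (s \<circ> inv q))"
    proof
      fix s
      show "gr_mult r a b s = (\<Sum>q | q permutes {1..r}. b q * a (s \<circ> inv q))"
      proof (cases "s permutes {1..r}")
        case False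
        hence "a (s \<circ> inv q) = 0" if "q permutes {1..r}" for q
          using group_ring_outside[OF aG] permutes_comp_right_iff[OF permutes_inv[OF that]] by blast
        thus ?thesis using False by (simp add: gr_mult_conv_right)
      qed (simp add: gr_mult_conv_right mult.commute)
    qed
    show ?thesis unfolding eq
      by (rule sum_in_if_closed) (use R a in \<open>auto simp: finite_permutations permutes_inv\<close>)
  qed
  thus ?L using R unfolding right_ideal_def by blast
qed

lemma two_sided_ideal_iff:
  fixes J :: "('k::field) group_ring_elt set"
  shows "two_sided_ideal r J \<longleftrightarrow> right_ideal r J \<and>
    (\<forall>a\<in>J. \<forall>q. q permutes {1..r} \<longrightarrow> (\<lambda>s. a (q \<circ> s)) \<in> J)" (is "?L \<longleftrightarrow> ?R")
proof
  assume L: ?L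
  have key: "(\<lambda>s. a (q \<circ> s)) \<in> J" if a: "a \<in> J" and q: "q permutes {1..r}" for a q
  proof -
    have aG: "a \<in> group_ring r" using L a by (auto simp: two_sided_ideal_def right_ideal_def)
    let ?b = "\<lambda>s. if s = inv q then 1 else 0"
    have iq: "inv q permutes {1..r}" using q by (rule permutes_inv)
    have "gr_mult r ?b a = (\<lambda>s. a (q \<circ> s))"
    proof
      fix s
      have "(\<Sum>p | p permutes {1..r}. ?b p * a (inv p \<circ> s))
          = (\<Sum>p | p permutes {1..r}. if p = inv q then a (q \<circ> s) else 0)"
        by (rule sum.cong) (auto simp: permutes_inv_inv[OF q])
      also have "\<dots> = a (q \<circ> s)" using iq by (simp add: finite_permutations)
      finally show "gr_mult r ?b a s = a (q \<circ> s)"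
        using group_ring_outside[OF aG] permutes_comp_left_iff[OF q]
        by (simp add: gr_mult_conv_left)
    qed
    moreover have "?b \<in> group_ring r" using iq by (auto simp: group_ring_def)
    ultimately show ?thesis using L a unfolding two_sided_ideal_def by metis
  qed
  thus ?R using L unfolding two_sided_ideal_def by blast
next
  assume R: ?R
  hence R': "right_ideal r J" by blast
  note R'' = R'[unfolded right_ideal_iff]
  have "gr_mult r b a \<in> J" if a: "a \<in> J" and b: "b \<in> group_ring r" for a b
  proof -
    have aG: "a \<in> group_ring r" using R'' a by auto
    have eq: "gr_mult r b a = (\<lambda>s. \<Sum>q | q permutes {1..r}. b q * a (inv q \<circ> s))"
    proof
      fix s
      show "gr_mult r b a s = (\<Sum>q | q permutes {1..r}. b q * a (inv q \<circ> s))"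
      proof (cases "s permutes {1..r}")
        case False
        hence "a (inv q \<circ> s) = 0" if "q permutes {1..r}" for q
          using group_ring_outside[OF aG] permutes_comp_left_iff[OF permutes_inv[OF that]] by blast
        thus ?thesis using False by (simp add: gr_mult_conv_left)
      qed (simp add: gr_mult_conv_left)
    qed
    have "(\<lambda>s. a (inv q \<circ> s)) \<in> J" if "q permutes {1..r}" for q
      using R a permutes_inv[OF that] by blast
    thus ?thesis unfolding eq
      by (intro sum_in_if_closed) (use R'' in \<open>auto simp: finite_permutations\<close>)
  qed
  thus ?L using R unfolding two_sided_ideal_def by blast
qed

text \<open>One-line notation with positions counted from 1. Points beyond the list are fixed, as
  \<open>permutes\<close> demands, so concrete permutations become lists that the simplifier can
  compare and evaluate.\<close>

definition perm_of_list :: "nat list \<Rightarrow> nat \<Rightarrow> nat" where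
  "perm_of_list l = (\<lambda>i. if 1 \<le> i \<and> i \<le> length l then l ! (i - 1) else i)"

lemma perm_of_list_map:
  assumes "p permutes {1..n}"
  shows "perm_of_list (map p [1..<Suc n]) = p"
proof
  fix i show "perm_of_list (map p [1..<Suc n]) i = p i"
    using assms by (auto simp: perm_of_list_def permutes_def simp del: upt_Suc)
qed

lemma map_perm_of_list: "map (perm_of_list l) [1..<Suc (length l)] = l"
  by (rule nth_equalityI) (auto simp: perm_of_list_def simp del: upt_Suc)

lemma perm_of_list_inject:
  "length l = length m \<Longrightarrow> perm_of_list l = perm_of_list m \<longleftrightarrow> l = m"
  by (metis map_perm_of_list)

lemma perm_of_list_permutes:
  assumes "distinct l" "set l = {1..n}"
  shows "perm_of_list l permutes {1..n}"
proof -
  have n: "length l = n" using assms distinct_card by fastforce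
  have m: "map (perm_of_list l) [1..<Suc n] = l" using map_perm_of_list n by metis
  have "bij_betw (perm_of_list l) {1..n} {1..n}"
    unfolding bij_betw_def
  proof
    show "inj_on (perm_of_list l) {1..n}"
      using assms(1) m by (metis atLeastLessThanSuc_atLeastAtMost distinct_map set_upt)
    show "perm_of_list l ` {1..n} = {1..n}"
      using assms(2) m by (metis atLeastLessThanSuc_atLeastAtMost set_map set_upt)
  qed
  thus ?thesis by (rule bij_imp_permutes) (auto simp: perm_of_list_def n)
qed

lemma permutes_3:
  "{p. p permutes {1..3}} = perm_of_list ` {[1,2,3],[1,3,2],[2,1,3],[2,3,1],[3,1,2],[3,2,1]}"
    (is "?L = ?R")
proof
  have iv: "{1..3} = {1,2,3::nat}" by auto
  show "?R \<subseteq> ?L"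
  proof (rule image_subsetI)
    fix l :: "nat list" assume "l \<in> {[1,2,3],[1,3,2],[2,1,3],[2,3,1],[3,1,2],[3,2,1]}"
    hence "distinct l" "set l = {1..3}" unfolding iv by auto
    thus "perm_of_list l \<in> ?L" using perm_of_list_permutes by blast
  qed
  show "?L \<subseteq> ?R"
  proof
    fix p assume "p \<in> ?L"
    hence p: "p permutes {1..3}" by simp
    have "p i \<in> {1..3}" if "i \<in> {1..3}" for i using permutes_in_image[OF p] that by blast
    hence i: "p 1 \<in> {1,2,3}" "p 2 \<in> {1,2,3}" "p 3 \<in> {1,2,3}" unfolding iv by auto
    have d: "p 1 \<noteq> p 2" "p 1 \<noteq> p 3" "p 2 \<noteq> p 3" using permutes_inj[OF p] by (simp_all add: inj_eq)
    have "map p [1..<Suc 3] = [p 1, p 2, p 3]" by (simp add: upt_rec numeral_2_eq_2 numeral_3_eq_3)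
    hence "p = perm_of_list [p 1, p 2, p 3]" using perm_of_list_map[OF p] by metis
    moreover have "[p 1, p 2, p 3] \<in> {[1,2,3],[1,3,2],[2,1,3],[2,3,1],[3,1,2],[3,2,1]}"
      using i d by (elim insertE emptyE) simp_all
    ultimately show "p \<in> ?R" by blast
  qed
qed

lemma sum_permutes_3:
  "(\<Sum>p | p permutes {1..3}. f p) =
    f (perm_of_list [1,2,3]) + f (perm_of_list [1,3,2]) + f (perm_of_list [2,1,3]) +
    f (perm_of_list [2,3,1]) + f (perm_of_list [3,1,2]) + f (perm_of_list [3,2,1])"
proof -
  have "inj_on perm_of_list {[1,2,3],[1,3,2],[2,1,3],[2,3,1],[3,1,2],[3,2,1]}"
    by (rule inj_onI) (auto simp: perm_of_list_inject)
  thus ?thesis unfolding permutes_3 by (simp add: sum.reindex add.assoc)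
qed

lemma all_permutes_3:
  "(\<forall>p. p permutes {1..3} \<longrightarrow> Q p) \<longleftrightarrow>
    Q (perm_of_list [1,2,3]) \<and> Q (perm_of_list [1,3,2]) \<and> Q (perm_of_list [2,1,3]) \<and>
    Q (perm_of_list [2,3,1]) \<and> Q (perm_of_list [3,1,2]) \<and> Q (perm_of_list [3,2,1])"
proof -
  have "(\<forall>p. p permutes {1..3} \<longrightarrow> Q p) \<longleftrightarrow> (\<forall>p\<in>{p. p permutes {1..3}}. Q p)" by blast
  thus ?thesis unfolding permutes_3 by simp
qed

section \<open>The ideals belonging to the partition (2 1)\<close>

definition wvec :: "'k::field \<Rightarrow> 'k \<Rightarrow> nat \<Rightarrow> 'k" where
  "wvec x y = (\<lambda>i. if i = 1 then x else if i = 2 then y else - x - y)"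

text \<open>The span of all functions s \<mapsto> w (s i) with w in W. Position 3 is absent because
  the coordinates of w add up to 0, which expresses w (s 3) through the other two values.\<close>

definition mcoeff :: "'k::field \<Rightarrow> 'k \<Rightarrow> 'k \<Rightarrow> 'k \<Rightarrow> 'k group_ring_elt" where
  "mcoeff x y x' y' =
    (\<lambda>s. if s permutes {1..3} then wvec x y (s 1) + wvec x' y' (s 2) else 0)"

definition std_block :: "('k::field) group_ring_elt set" where
  "std_block = {mcoeff x y x' y' | x y x' y'. True}"

text \<open>Both vectors of \<open>mcoeff\<close> are confined to one line of W. Right translation
  mixes the two slots and preserves the line, whereas left translation moves the line.\<close>

definition line_ideal :: "'k::field \<Rightarrow> 'k \<Rightarrow> 'k group_ring_elt set" where
  "line_ideal x y = {mcoeff (c * x) (c * y) (d * x) (d * y) | c d. True}"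

lemma line_idealI: "a = mcoeff (c * x) (c * y) (d * x) (d * y) \<Longrightarrow> a \<in> line_ideal x y"
  by (auto simp: line_ideal_def)

lemma fun_eq_permutes_3:
  fixes a b :: "('k::field) group_ring_elt"
  assumes "a \<in> group_ring 3" "b \<in> group_ring 3"
  shows "a = b \<longleftrightarrow>
    a (perm_of_list [1,2,3]) = b (perm_of_list [1,2,3]) \<and>
    a (perm_of_list [1,3,2]) = b (perm_of_list [1,3,2]) \<and>
    a (perm_of_list [2,1,3]) = b (perm_of_list [2,1,3]) \<and>
    a (perm_of_list [2,3,1]) = b (perm_of_list [2,3,1]) \<and>
    a (perm_of_list [3,1,2]) = b (perm_of_list [3,1,2]) \<and>
    a (perm_of_list [3,2,1]) = b (perm_of_list [3,2,1])"
proof -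
  have "a = b \<longleftrightarrow> (\<forall>s. s permutes {1..3} \<longrightarrow> a s = b s)"
    using assms by (force simp: group_ring_def fun_eq_iff)
  thus ?thesis unfolding all_permutes_3 .
qed

lemma perm_of_list_3 [simp]:
  "perm_of_list [a,b,c] (Suc 0) = a" "perm_of_list [a,b,c] 2 = b" "perm_of_list [a,b,c] 3 = c"
  by (auto simp: perm_of_list_def numeral_2_eq_2 numeral_3_eq_3)

lemma wvec_simps [simp]: "wvec x y (Suc 0) = x" "wvec x y 2 = y" "wvec x y 3 = - x - y"
  by (auto simp: wvec_def)

lemma perm_of_list_3_permutes [simp]:
  "perm_of_list [Suc 0,2,3] permutes {Suc 0..3}" "perm_of_list [Suc 0,3,2] permutes {Suc 0..3}"
  "perm_of_list [2,Suc 0,3] permutes {Suc 0..3}" "perm_of_list [2,3,Suc 0] permutes {Suc 0..3}"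
  "perm_of_list [3,Suc 0,2] permutes {Suc 0..3}" "perm_of_list [3,2,Suc 0] permutes {Suc 0..3}"
  using permutes_3 by auto

lemma mcoeff_in_group_ring [simp]: "mcoeff x y x' y' \<in> group_ring 3"
  by (simp add: mcoeff_def group_ring_def)

text \<open>Adding the values at the two s with s 1 = 1 gives 2x - x', and at those with s 2 = 1 it
  gives 2x' - x; the same holds for y with the value 2. This system has determinant 3, so twice the
  first sum plus the second isolates 3x.\<close>

lemma mcoeff_eq_iff:
  fixes x :: "'k::field_char_0"
  shows "mcoeff x y x' y' = mcoeff u v u' v' \<longleftrightarrow> x = u \<and> y = v \<and> x' = u' \<and> y' = v'"
proof
  assume "mcoeff x y x' y' = mcoeff u v u' v'"
  hence e: "x + y' = u + v'" "x - x' - y' = u - u' - v'" "y + x' = v + u'"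
    "y - x' - y' = v - u' - v'" "x' - x - y = u' - u - v" "y' - x - y = v' - u - v"
    unfolding fun_eq_permutes_3[OF mcoeff_in_group_ring mcoeff_in_group_ring]
    by (simp_all add: mcoeff_def algebra_simps)
  have "3 * x = 2 * (x + y' + (x - x' - y')) + (y + x' + (x' - x - y))" by simp
  also have "\<dots> = 3 * u" unfolding e by simp
  finally have 1: "x = u" by simp
  have "3 * y = 2 * (y + x' + (y - x' - y')) + (x + y' + (y' - x - y))" by simp
  also have "\<dots> = 3 * v" unfolding e by simp
  finally have 2: "y = v" by simp
  show "x = u \<and> y = v \<and> x' = u' \<and> y' = v'" using 1 2 e by simp
qed simp

lemma mcoeff_0: "mcoeff 0 0 0 0 = (\<lambda>_. 0)"
  by (auto simp: mcoeff_def wvec_def)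

lemma mcoeff_add:
  "(\<lambda>s. mcoeff x y x' y' s + mcoeff u v u' v' s) = mcoeff (x + u) (y + v) (x' + u') (y' + v')"
  by (auto simp: mcoeff_def wvec_def fun_eq_iff algebra_simps)

lemma mcoeff_scale: "(\<lambda>s. c * mcoeff x y x' y' s) = mcoeff (c * x) (c * y) (c * x') (c * y')"
  by (auto simp: mcoeff_def wvec_def fun_eq_iff algebra_simps)

lemma sum_wvec_permutes:
  assumes "s permutes {1..3}"
  shows "wvec x y (s 3) = - wvec x y (s 1) - wvec x y (s 2)"
proof -
  have "\<forall>s. s permutes {1..3} \<longrightarrow> wvec x y (s 3) = - wvec x y (s 1) - wvec x y (s 2)"
    unfolding all_permutes_3 by simp
  thus ?thesis using assms by blast
qed

lemma wvec_comp:
  assumes "q permutes {1..3}" "i \<in> {1..3}"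
  shows "wvec x y (q i) = wvec (wvec x y (q 1)) (wvec x y (q 2)) i"
proof -
  have "i = 1 \<or> i = 2 \<or> i = 3" using assms(2) by auto
  thus ?thesis using sum_wvec_permutes[OF assms(1), of x y] by auto
qed

lemma mcoeff_left:
  assumes q: "q permutes {1..3}"
  shows "(\<lambda>s. mcoeff x y x' y' (q \<circ> s)) =
    mcoeff (wvec x y (q 1)) (wvec x y (q 2)) (wvec x' y' (q 1)) (wvec x' y' (q 2))"
proof
  fix s
  show "mcoeff x y x' y' (q \<circ> s) =
    mcoeff (wvec x y (q 1)) (wvec x y (q 2)) (wvec x' y' (q 1)) (wvec x' y' (q 2)) s"
  proof (cases "s permutes {1..3}")
    case True
    have "s 1 \<in> {1..3}" "s 2 \<in> {1..3}"
      unfolding permutes_in_image[OF True] by auto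
    note e = wvec_comp[OF q this(1), of x y] wvec_comp[OF q this(2), of x' y']
    show ?thesis
      using True permutes_comp_left_iff[OF q, of s]
      unfolding mcoeff_def o_apply e by (simp only: if_True)
  next
    case False
    thus ?thesis using permutes_comp_left_iff[OF q] by (simp add: mcoeff_def)
  qed
qed

lemma mcoeff_right_12:
  "(\<lambda>s. mcoeff x y x' y' (s \<circ> perm_of_list [2,1,3])) = mcoeff x' y' x y"
  using permutes_comp_right_iff[of "perm_of_list [2,1,3]" "{1..3}"]
  by (auto simp: mcoeff_def fun_eq_iff algebra_simps)

text \<open>Right translation permutes the three values w (s 1), w (s 2), w (s 3), so it acts on the
  pair of vectors by a 2x2 matrix that depends on q alone. The matrix entries are quantified before
  the vectors: this is what makes \<open>line_ideal\<close> invariant.\<close>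

lemma mcoeff_right:
  fixes q :: "nat \<Rightarrow> nat"
  assumes "q permutes {1..3}"
  shows "\<exists>a b c d :: 'k. \<forall>x y x' y' :: 'k :: field. (\<lambda>s. mcoeff x y x' y' (s \<circ> q)) =
    mcoeff (a * x + b * x') (a * y + b * y') (c * x + d * x') (c * y + d * y')"
proof -
  have iv: "q 1 \<in> {1..3}" "q 2 \<in> {1..3}" unfolding permutes_in_image[OF assms] by auto
  have ex: "\<exists>a c :: 'k. \<forall>x y s. s permutes {1..3} \<longrightarrow> wvec x y (s i) = a * wvec x y (s 1) + c * wvec x y (s 2)"
    if "i \<in> {1..3}" for i
  proof -
    have "i = 1 \<or> i = 2 \<or> i = 3" using that by auto
    moreover have "\<forall>x y :: 'k. \<forall>s. s permutes {1..3} \<longrightarrow> wvec x y (s 1) = 1 * wvec x y (s 1) + 0 * wvec x y (s 2)"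
      "\<forall>x y :: 'k. \<forall>s. s permutes {1..3} \<longrightarrow> wvec x y (s 2) = 0 * wvec x y (s 1) + 1 * wvec x y (s 2)"
      "\<forall>x y :: 'k. \<forall>s. s permutes {1..3} \<longrightarrow> wvec x y (s 3) = -1 * wvec x y (s 1) + (-1) * wvec x y (s 2)"
      using sum_wvec_permutes by fastforce+
    ultimately show ?thesis by metis
  qed
  obtain a c :: 'k where ac: "\<And>x y s. s permutes {1..3} \<Longrightarrow> wvec x y (s (q 1)) = a * wvec x y (s 1) + c * wvec x y (s 2)"
    using ex[OF iv(1)] by blast
  obtain b d :: 'k where bd: "\<And>x y s. s permutes {1..3} \<Longrightarrow> wvec x y (s (q 2)) = b * wvec x y (s 1) + d * wvec x y (s 2)"
    using ex[OF iv(2)] by blast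
  have "(\<lambda>s. mcoeff x y x' y' (s \<circ> q)) =
    mcoeff (a * x + b * x') (a * y + b * y') (c * x + d * x') (c * y + d * y')" for x y x' y' :: 'k
  proof
    fix s
    have "wvec (e * x + f * x') (e * y + f * y') i = e * wvec x y i + f * wvec x' y' i" for e f i
      by (simp add: wvec_def algebra_simps)
    thus "mcoeff x y x' y' (s \<circ> q) =
        mcoeff (a * x + b * x') (a * y + b * y') (c * x + d * x') (c * y + d * y') s"
      using permutes_comp_right_iff[OF assms, of s] ac[of s x y] bd[of s x' y']
      by (simp add: mcoeff_def)
  qed
  thus ?thesis by blast
qed

lemma right_ideal_line_ideal: "right_ideal 3 (line_ideal x (y :: 'a :: field))"
  unfolding right_ideal_iff
proof (intro conjI ballI allI impI)
  show "line_ideal x y \<subseteq> group_ring 3" by (auto simp: line_ideal_def)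
  have "mcoeff (0 * x) (0 * y) (0 * x) (0 * y) \<in> line_ideal x y" unfolding line_ideal_def by blast
  thus "(\<lambda>_. 0) \<in> line_ideal x y" by (simp add: mcoeff_0)
  fix a assume "a \<in> line_ideal x y"
  then obtain c d where a: "a = mcoeff (c * x) (c * y) (d * x) (d * y)"
    by (auto simp: line_ideal_def)
  {
    fix b assume "b \<in> line_ideal x y"
    then obtain c' d' where b: "b = mcoeff (c' * x) (c' * y) (d' * x) (d' * y)"
      by (auto simp: line_ideal_def)
    show "(\<lambda>p. a p + b p) \<in> line_ideal x y"
      unfolding a b mcoeff_add
      by (rule line_idealI[of _ "c + c'" _ _ "d + d'"]) (simp add: algebra_simps)
  next
    fix e show "(\<lambda>p. e * a p) \<in> line_ideal x y"
      unfolding a mcoeff_scale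
      by (rule line_idealI[of _ "e * c" _ _ "e * d"]) (simp add: algebra_simps)
  next
    fix q assume "q permutes {1..3::nat}"
    from mcoeff_right[OF this] obtain e f g h :: 'a where q:
      "\<And>x y x' y' :: 'a. (\<lambda>s. mcoeff x y x' y' (s \<circ> q)) =
        mcoeff (e * x + f * x') (e * y + f * y') (g * x + h * x') (g * y + h * y')" by blast
    show "(\<lambda>s. a (s \<circ> q)) \<in> line_ideal x y"
      unfolding a q
      by (rule line_idealI[of _ "e * c + f * d" _ _ "g * c + h * d"]) (simp add: algebra_simps)
  }
qed

lemma two_sided_ideal_std_block: "two_sided_ideal 3 (std_block :: ('a::field) group_ring_elt set)"
  unfolding two_sided_ideal_iff right_ideal_iff
proof (intro conjI ballI allI impI)
  show "std_block \<subseteq> (group_ring 3 :: 'a group_ring_elt set)" by (auto simp: std_block_def)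
  have "mcoeff 0 0 0 (0::'a) \<in> std_block" unfolding std_block_def by blast
  thus "(\<lambda>_. 0::'a) \<in> std_block" by (simp add: mcoeff_0)
  fix a :: "'a group_ring_elt" assume "a \<in> std_block"
  then obtain x y x' y' where a: "a = mcoeff x y x' y'" by (auto simp: std_block_def)
  {
    fix b :: "'a group_ring_elt" assume "b \<in> std_block"
    then obtain u v u' v' where b: "b = mcoeff u v u' v'" by (auto simp: std_block_def)
    show "(\<lambda>p. a p + b p) \<in> std_block" unfolding std_block_def a b mcoeff_add by blast
  next
    fix e show "(\<lambda>p. e * a p) \<in> std_block" unfolding std_block_def a mcoeff_scale by blast
  next
    fix q assume q: "q permutes {1..3::nat}"
    from mcoeff_right[OF q] obtain e f g h where
      "(\<lambda>s. a (s \<circ> q)) =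
        mcoeff (e * x + f * x') (e * y + f * y') (g * x + h * x') (g * y + h * y')" unfolding a by blast
    thus "(\<lambda>s. a (s \<circ> q)) \<in> std_block" unfolding std_block_def by blast
    show "(\<lambda>s. a (q \<circ> s)) \<in> std_block" unfolding std_block_def a mcoeff_left[OF q] by blast
  }
qed

lemma line_ideal_subset_std_block: "line_ideal x y \<subseteq> std_block"
  by (auto simp: line_ideal_def std_block_def)

text \<open>Adding the translate by (2 3) turns the slots w, w' into 2w - w', 0 and thus clears the
  second slot. Doing the same after exchanging the slots gives 2w' - w, and 2(2w - w') + (2w' - w) =
  3w separates w from w'.\<close>

lemma line_ideal_subset:
  fixes J :: "('k::field_char_0) group_ring_elt set"
  assumes J: "right_ideal 3 J" and a: "mcoeff x y x' y' \<in> J"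
  shows "line_ideal x y \<subseteq> J" "line_ideal x' y' \<subseteq> J"
proof -
  note J' = J[unfolded right_ideal_iff]
  have add: "mcoeff (x + u) (y + v) (x' + u') (y' + v') \<in> J"
    if "mcoeff x y x' y' \<in> J" "mcoeff u v u' v' \<in> J" for x y x' y' u v u' v'
    using J' that unfolding mcoeff_add[symmetric] by blast
  have scale: "mcoeff (c * x) (c * y) (c * x') (c * y') \<in> J"
    if "mcoeff x y x' y' \<in> J" for c x y x' y'
    using J' that unfolding mcoeff_scale[symmetric] by blast
  have sw: "mcoeff x' y' x y \<in> J" if "mcoeff x y x' y' \<in> J" for x y x' y'
  proof -
    have "perm_of_list [2,1,3] permutes {1..3}" by simp
    hence "(\<lambda>s. mcoeff x y x' y' (s \<circ> perm_of_list [2,1,3])) \<in> J" using J' that by blast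
    thus ?thesis by (simp only: mcoeff_right_12)
  qed
  have r23: "mcoeff (x - x') (y - y') (- x') (- y') \<in> J" if "mcoeff x y x' y' \<in> J" for x y x' y'
  proof -
    have q: "perm_of_list [1,3,2] permutes {1..3}" by simp
    have "(\<lambda>s. mcoeff x y x' y' (s \<circ> perm_of_list [1,3,2])) = mcoeff (x - x') (y - y') (- x') (- y')"
      using permutes_comp_right_iff[OF q] sum_wvec_permutes[of _ x' y']
      by (auto simp: mcoeff_def wvec_def fun_eq_iff)
    moreover have "(\<lambda>s. mcoeff x y x' y' (s \<circ> perm_of_list [1,3,2])) \<in> J"
      using J' that q by blast
    ultimately show ?thesis by simp
  qed
  have *: "line_ideal x y \<subseteq> J" if m: "mcoeff x y x' y' \<in> J" for x y x' y'
  proof -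
    have "mcoeff (2 * x - x') (2 * y - y') 0 0 \<in> J"
      using add[OF m r23[OF m]] by (simp add: algebra_simps)
    from scale[OF this, of 2]
    have 1: "mcoeff (4 * x - 2 * x') (4 * y - 2 * y') 0 0 \<in> J" by (simp add: algebra_simps)
    have 2: "mcoeff (2 * x' - x) (2 * y' - y) 0 0 \<in> J"
      using add[OF sw[OF m] r23[OF sw[OF m]]] by (simp add: algebra_simps)
    have "mcoeff (3 * x) (3 * y) 0 0 \<in> J" using add[OF 1 2] by (simp add: algebra_simps)
    from scale[OF this, of "1/3"] have 3: "mcoeff x y 0 0 \<in> J" by simp
    have "mcoeff (c * x) (c * y) (d * x) (d * y) \<in> J" for c d
      using add[OF scale[OF 3, of c] scale[OF sw[OF 3], of d]] by simp
    thus ?thesis by (auto simp: line_ideal_def)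
  qed
  show "line_ideal x y \<subseteq> J" using *[OF a] .
  show "line_ideal x' y' \<subseteq> J" using *[OF sw[OF a]] .
qed

lemma line_ideal_exists:
  fixes J :: "('k::field_char_0) group_ring_elt set"
  assumes "right_ideal 3 J" "J \<subseteq> std_block" "J \<noteq> {\<lambda>_. 0}"
  obtains x y where "(x, y) \<noteq> (0, 0)" "line_ideal x y \<subseteq> J"
proof -
  have "(\<lambda>_. 0) \<in> J" using assms(1) by (simp add: right_ideal_def)
  then obtain a where "a \<in> J" "a \<noteq> (\<lambda>_. 0)" using assms(3) by blast
  moreover from this obtain x y x' y' where "a = mcoeff x y x' y'"
    using assms(2) by (auto simp: std_block_def)
  ultimately show thesis
    using that[of x y] that[of x' y'] line_ideal_subset[OF assms(1), of x y x' y']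
    by (cases "(x, y) = (0, 0)"; cases "(x', y') = (0, 0)") (auto simp: mcoeff_0)
qed

lemma mcoeff_in_line_ideal: "mcoeff x y 0 0 \<in> line_ideal x y"
  by (rule line_idealI[of _ 1 _ _ 0]) simp

lemma line_ideal_scale:
  assumes "c \<noteq> 0"
  shows "line_ideal (c * x) (c * y) = line_ideal x (y :: 'k::field)"
proof
  show "line_ideal (c * x) (c * y) \<subseteq> line_ideal x y"
    unfolding line_ideal_def by (simp add: mult.assoc[symmetric]) blast
  have "mcoeff (e * x) (e * y) (d * x) (d * y) =
    mcoeff (e / c * (c * x)) (e / c * (c * y)) (d / c * (c * x)) (d / c * (c * y))" for d e
    using assms by simp
  thus "line_ideal x y \<subseteq> line_ideal (c * x) (c * y)"
    unfolding line_ideal_def by blast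
qed

lemma line_ideal_subset_line_ideal:
  fixes x y :: "'k::field_char_0"
  assumes "line_ideal x y \<subseteq> line_ideal u v"
  shows "\<exists>c. x = c * u \<and> y = c * v"
proof -
  have "mcoeff x y 0 0 \<in> line_ideal u v" using assms mcoeff_in_line_ideal by blast
  thus ?thesis by (auto simp: line_ideal_def mcoeff_eq_iff)
qed

text \<open>A nonzero subideal contains the line ideal of some nonzero vector; that vector is a
  multiple of (x, y), and the factor is invertible.\<close>

lemma minimal_line_ideal:
  fixes x y :: "'k::field_char_0"
  assumes "(x, y) \<noteq> (0, 0)"
  shows "minimal_right_ideal 3 (line_ideal x y)"
  unfolding minimal_right_ideal_def
proof (intro conjI allI impI)
  show "right_ideal 3 (line_ideal x y)" by (rule right_ideal_line_ideal)
  have "mcoeff x y 0 0 \<noteq> mcoeff 0 0 0 0" using assms by (auto simp: mcoeff_eq_iff)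
  thus "line_ideal x y \<noteq> {\<lambda>_. 0}" using mcoeff_in_line_ideal[of x y] unfolding mcoeff_0 by auto
  fix J assume J: "right_ideal 3 J \<and> J \<subseteq> line_ideal x y"
  show "J = {\<lambda>_. 0} \<or> J = line_ideal x y"
  proof (cases "J = {\<lambda>_. 0}")
    case False
    then obtain u v where uv: "(u, v) \<noteq> (0, 0)" "line_ideal u v \<subseteq> J"
      using line_ideal_exists[of J] J line_ideal_subset_std_block by blast
    then obtain c where "u = c * x" "v = c * y"
      using line_ideal_subset_line_ideal J by (meson subset_trans)
    moreover from this have "c \<noteq> 0" using uv(1) by auto
    ultimately have "line_ideal x y \<subseteq> J" using line_ideal_scale uv(2) by metis
    thus ?thesis using J by blast
  qed simp
qed

lemma minimal_right_ideal_in_std_block: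
  fixes J :: "('k::field_char_0) group_ring_elt set"
  assumes "minimal_right_ideal 3 J" "J \<subseteq> std_block"
  obtains x y where "(x, y) \<noteq> (0, 0)" "J = line_ideal x y"
proof -
  have J: "right_ideal 3 J" "J \<noteq> {\<lambda>_. 0}" using assms(1) by (auto simp: minimal_right_ideal_def)
  obtain x y where xy: "(x, y) \<noteq> (0, 0)" "line_ideal x y \<subseteq> J"
    by (rule line_ideal_exists[OF J(1) assms(2) J(2)])
  have "line_ideal x y \<noteq> {\<lambda>_. 0}" using minimal_line_ideal[OF xy(1)] by (simp add: minimal_right_ideal_def)
  hence "J = line_ideal x y"
    using assms(1) xy(2) right_ideal_line_ideal unfolding minimal_right_ideal_def by metis
  thus thesis using that xy(1) by blast
qed

text \<open>This is the irreducibility of W: a nonzero two-sided subideal contains a line ideal,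
  left translation carries it to the other lines of the orbit, and the translates of one nonzero
  vector span W.\<close>

lemma minimal_std_block: "minimal_two_sided_ideal 3 (std_block :: ('k::field_char_0) group_ring_elt set)"
  unfolding minimal_two_sided_ideal_def
proof (intro conjI allI impI)
  show "two_sided_ideal 3 (std_block :: 'k group_ring_elt set)" by (rule two_sided_ideal_std_block)
  have "mcoeff 1 0 0 (0::'k) \<noteq> mcoeff 0 0 0 0" by (simp add: mcoeff_eq_iff)
  moreover have "mcoeff 1 0 0 (0::'k) \<in> std_block" unfolding std_block_def by blast
  ultimately show "std_block \<noteq> {\<lambda>_. 0::'k}" unfolding mcoeff_0 by auto
  fix J :: "'k group_ring_elt set" assume "two_sided_ideal 3 J \<and> J \<subseteq> std_block"
  hence J: "two_sided_ideal 3 J" "right_ideal 3 J" "J \<subseteq> std_block"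
    by (auto simp: two_sided_ideal_def)
  note add = J(2)[unfolded right_ideal_iff, THEN conjunct2, THEN conjunct2, THEN conjunct1, rule_format]
  show "J = {\<lambda>_. 0} \<or> J = std_block"
  proof (cases "J = {\<lambda>_. 0}")
    case False
    then obtain x y where xy: "(x, y) \<noteq> (0, 0)" "line_ideal x y \<subseteq> J"
      using line_ideal_exists J by blast
    have left: "line_ideal (wvec x y (q 1)) (wvec x y (q 2)) \<subseteq> J"
      if "q permutes {1..3}" "line_ideal x y \<subseteq> J" for q x y
    proof -
      have "(\<lambda>s. mcoeff x y 0 0 (q \<circ> s)) \<in> J"
        using J(1) that mcoeff_in_line_ideal unfolding two_sided_ideal_iff by blast
      moreover have "wvec 0 0 i = (0::'k)" for i by (simp add: wvec_def)
      ultimately have "mcoeff (wvec x y (q 1)) (wvec x y (q 2)) 0 0 \<in> J"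
        unfolding mcoeff_left[OF that(1)] by simp
      thus ?thesis using line_ideal_subset(1) J(2) by blast
    qed
    have plus: "line_ideal (x + u) (y + v) \<subseteq> J"
      if "line_ideal x y \<subseteq> J" "line_ideal u v \<subseteq> J" for x y u v
    proof -
      have "mcoeff x y 0 0 \<in> J" "mcoeff u v 0 0 \<in> J" using that mcoeff_in_line_ideal by blast+
      from add[OF this] have "mcoeff (x + u) (y + v) 0 0 \<in> J" by (simp add: mcoeff_add)
      thus ?thesis using line_ideal_subset(1) J(2) by blast
    qed
    have sw: "line_ideal y x \<subseteq> J" if "line_ideal x y \<subseteq> J" for x y
      using left[of "perm_of_list [2,1,3]" x y] that by simp
    have r23: "line_ideal x (- x - y) \<subseteq> J" if "line_ideal x y \<subseteq> J" for x y
      using left[of "perm_of_list [1,3,2]" x y] that by simp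
    \<comment> \<open>A vector plus its image under (2 3) is x (2, -1, -1), whatever y is. If x = 0,
      the exchanged vector is used instead.\<close>
    have one: "line_ideal (2 * x) (- x) \<subseteq> J" if "line_ideal x y \<subseteq> J" for x y
      using plus[OF that r23[OF that]] by (simp add: algebra_simps)
    obtain z where z: "z \<noteq> 0" "line_ideal (2 * z) (- z) \<subseteq> J"
      using one[OF xy(2)] one[OF sw[OF xy(2)]] xy(1) by auto
    have i21: "line_ideal 2 (-1) \<subseteq> J"
      using z line_ideal_scale[of z 2 "-1"] by (simp add: mult.commute)
    \<comment> \<open>Twice (2, -1, -1) plus (-1, 2, -1) equals (3, 0, -3).\<close>
    have "line_ideal (2 + 2 + -1) (- 1 + -1 + 2) \<subseteq> J"
      by (intro plus i21 sw[OF i21])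
    hence e1: "line_ideal 1 0 \<subseteq> J" using line_ideal_scale[of "3::'k" 1 0] by simp
    have "mcoeff x y x' y' \<in> J" for x y x' y'
    proof -
      have s1: "line_ideal x 0 \<subseteq> J" and s2: "line_ideal 0 x \<subseteq> J" for x
      proof -
        show "line_ideal x 0 \<subseteq> J"
        proof (cases "x = 0")
          case True
          then show ?thesis using J(2) by (auto simp: line_ideal_def right_ideal_def mcoeff_0)
        next
          case False
          then show ?thesis using e1 line_ideal_scale[of x 1 0] by simp
        qed
        thus "line_ideal 0 x \<subseteq> J" by (rule sw)
      qed
      have "line_ideal x y \<subseteq> J" "line_ideal x' y' \<subseteq> J"
        using plus[OF s1[of x] s2[of y]] plus[OF s1[of x'] s2[of y']] by simp_all
      moreover have "mcoeff 0 0 x' y' \<in> line_ideal x' y'"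
        by (rule line_idealI[of _ 0 _ _ 1]) simp
      ultimately have "mcoeff x y 0 0 \<in> J" "mcoeff 0 0 x' y' \<in> J" using mcoeff_in_line_ideal by blast+
      from add[OF this] show ?thesis by (simp add: mcoeff_add)
    qed
    thus ?thesis using J(3) by (auto simp: std_block_def)
  qed simp
qed

text \<open>Written as products of transpositions, the six lists have signs and inverses that
  library rules can compute.\<close>

lemma perm_of_list_3_eqs:
  "id = perm_of_list [1,2,3]" "transpose 2 3 = perm_of_list [1,3,2]"
  "transpose 1 2 = perm_of_list [2,1,3]" "transpose 1 3 = perm_of_list [3,2,1]"
  "transpose 1 2 \<circ> transpose 2 3 = perm_of_list [2,3,1]"
  "transpose 2 3 \<circ> transpose 1 2 = perm_of_list [3,1,2]"
proof -
  have *: "p = perm_of_list [p 1, p 2, p 3]" if "\<And>i. i \<notin> {1,2,3} \<Longrightarrow> p i = i" for p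
  proof
    fix i show "p i = perm_of_list [p 1, p 2, p 3] i"
    proof (cases "i \<in> {1,2,3}")
      case False
      hence "i = 0 \<or> 3 < i" by auto
      thus ?thesis using that[OF False] by (auto simp: perm_of_list_def)
    qed auto
  qed
  show "id = perm_of_list [1,2,3]"
    using *[of "id"] by (simp add: transpose_def)
  show "transpose 2 3 = perm_of_list [1,3,2]"
    using *[of "transpose 2 3"] by (simp add: transpose_def)
  show "transpose 1 2 = perm_of_list [2,1,3]"
    using *[of "transpose 1 2"] by (simp add: transpose_def)
  show "transpose 1 3 = perm_of_list [3,2,1]"
    using *[of "transpose 1 3"] by (simp add: transpose_def)
  show "transpose 1 2 \<circ> transpose 2 3 = perm_of_list [2,3,1]"
    using *[of "transpose 1 2 \<circ> transpose 2 3"] by (simp add: transpose_def)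
  show "transpose 2 3 \<circ> transpose 1 2 = perm_of_list [3,1,2]"
    using *[of "transpose 2 3 \<circ> transpose 1 2"] by (simp add: transpose_def)
qed

lemma inv_perm_of_list_3:
  "inv (perm_of_list [1,2,3]) = perm_of_list [1,2,3]"
  "inv (perm_of_list [1,3,2]) = perm_of_list [1,3,2]"
  "inv (perm_of_list [2,1,3]) = perm_of_list [2,1,3]"
  "inv (perm_of_list [2,3,1]) = perm_of_list [3,1,2]"
  "inv (perm_of_list [3,1,2]) = perm_of_list [2,3,1]"
  "inv (perm_of_list [3,2,1]) = perm_of_list [3,2,1]"
  unfolding perm_of_list_3_eqs[symmetric] by (simp_all add: o_inv_distrib)

lemma sign_perm_of_list_3:
  "sign (perm_of_list [1,2,3]) = 1" "sign (perm_of_list [1,3,2]) = -1"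
  "sign (perm_of_list [2,1,3]) = -1" "sign (perm_of_list [2,3,1]) = 1"
  "sign (perm_of_list [3,1,2]) = 1" "sign (perm_of_list [3,2,1]) = -1"
  unfolding perm_of_list_3_eqs[symmetric]
  by (simp_all add: sign_compose permutation_swap_id sign_swap_id)

text \<open>The block consists of the elements killed by the trivial and by the sign character. The
  two conditions together say that the values on even and on odd permutations each add up to 0,
  which leaves the four parameters of \<open>mcoeff\<close>.\<close>

lemma std_blockI:
  fixes a :: "('k::field_char_0) group_ring_elt"
  assumes "a \<in> group_ring 3" "(\<Sum>s | s permutes {1..3}. a s) = 0"
    "(\<Sum>s | s permutes {1..3}. a s * of_int (sign s)) = 0"
  shows "a \<in> std_block"
proof -
  let ?a = "\<lambda>i j k. a (perm_of_list [i,j,k])"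
  let ?A = "?a 1 2 3 + ?a 1 3 2" and ?B = "?a 2 1 3 + ?a 3 1 2"
  let ?C = "?a 2 1 3 + ?a 2 3 1" and ?D = "?a 1 2 3 + ?a 3 2 1"
  have "?a 1 2 3 + ?a 1 3 2 + ?a 2 1 3 + ?a 2 3 1 + ?a 3 1 2 + ?a 3 2 1 = 0"
    using assms(2) unfolding sum_permutes_3 .
  moreover have "?a 1 2 3 - ?a 1 3 2 - ?a 2 1 3 + ?a 2 3 1 + ?a 3 1 2 - ?a 3 2 1 = 0"
    using assms(3) unfolding sum_permutes_3 sign_perm_of_list_3 by simp
  moreover have "u = - (v + w) \<and> x = - (y + z)" if "u + x + y + v + w + z = 0" "u - x - y + v + w - z = 0"
    for u v w x y z :: 'k
  proof -
    have "2 * (u + v + w) = (u + x + y + v + w + z) + (u - x - y + v + w - z)" by (simp add: algebra_simps)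
    also have "\<dots> = 0" unfolding that by simp
    finally have 1: "u + v + w = 0" using mult_eq_0_iff[of 2 "u + v + w"] by (metis zero_neq_numeral)
    have "x + y + z = (u + x + y + v + w + z) - (u + v + w)" by simp
    hence "x + y + z = 0" unfolding that(1) 1 by simp
    thus ?thesis using 1 eq_neg_iff_add_eq_0 by (metis add.assoc)
  qed
  ultimately have e: "?a 1 2 3 = - (?a 2 3 1 + ?a 3 1 2)" "?a 1 3 2 = - (?a 2 1 3 + ?a 3 2 1)"
    by blast+
  \<comment> \<open>\<open>?A\<close>, \<open>?B\<close>, \<open>?C\<close>, \<open>?D\<close> are
    the sums over s 1 = 1, s 2 = 1, s 1 = 2, s 2 = 2. They should equal 2x - x', 2x' - x, 2y - y',
    2y' - y; the displayed arguments invert these equations.\<close>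
  have "a = mcoeff ((2 * ?A + ?B) / 3) ((2 * ?C + ?D) / 3) ((2 * ?B + ?A) / 3) ((2 * ?D + ?C) / 3)"
    unfolding fun_eq_permutes_3[OF assms(1) mcoeff_in_group_ring] e
    by (simp add: mcoeff_def field_simps)
  thus ?thesis unfolding std_block_def by blast
qed

section \<open>Young symmetrizers and the block of the frame (2 1)\<close>

lemma row_group_permutes: "p \<in> row_group t \<Longrightarrow> p permutes set (concat t)"
  by (simp add: row_group_def)

lemma column_group_permutes: "p \<in> column_group t \<Longrightarrow> p permutes set (concat t)"
  by (simp add: column_group_def)

lemma finite_row_group: "finite (row_group t)"
  by (rule finite_subset[OF _ finite_permutations[of "set (concat t)"]]) (auto simp: row_group_def)

lemma finite_column_group: "finite (column_group t)"
  by (rule finite_subset[OF _ finite_permutations[of "set (concat t)"]]) (auto simp: column_group_def)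

lemma inv_image_permutes: "p permutes A \<Longrightarrow> p ` B = B \<Longrightarrow> inv p ` B = B"
  by (metis image_inv_f_f permutes_inj)

lemma bij_inv_row_group: "bij_betw inv (row_group t) (row_group t)"
proof -
  have "inv p \<in> row_group t" if "p \<in> row_group t" for p
    using that permutes_inv[OF row_group_permutes[OF that]]
      inv_image_permutes[OF row_group_permutes[OF that]]
    by (simp add: row_group_def del: set_concat)
  moreover have "inv (inv p) = p" if "p \<in> row_group t" for p
    by (rule permutes_inv_inv[OF row_group_permutes[OF that]])
  ultimately show ?thesis
    by (intro bij_betw_byWitness[where f' = inv]) auto
qed

lemma bij_inv_column_group: "bij_betw inv (column_group t) (column_group t)"
proof -
  have "inv p \<in> column_group t" if "p \<in> column_group t" for p
    using that permutes_inv[OF column_group_permutes[OF that]]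
      inv_image_permutes[OF column_group_permutes[OF that]]
    by (simp add: column_group_def del: set_concat)
  moreover have "inv (inv p) = p" if "p \<in> column_group t" for p
    by (rule permutes_inv_inv[OF column_group_permutes[OF that]])
  ultimately show ?thesis
    by (intro bij_betw_byWitness[where f' = inv]) auto
qed

text \<open>Weighted sums over the whole group become sums over the row and column groups, so
  individual coefficients of a symmetrizer need not be computed.\<close>

lemma sum_young_symmetrizer:
  fixes f :: "(nat \<Rightarrow> nat) \<Rightarrow> 'k::field"
  assumes "set (concat t) = {1..n}"
  shows "(\<Sum>s | s permutes {1..n}. young_symmetrizer t s * f s) =
    (\<Sum>p\<in>row_group t. \<Sum>q\<in>column_group t. of_int (sign q) * f (p \<circ> q))"
proof -
  let ?S = "{s. s permutes {1..n}}"
  have "(\<Sum>s\<in>?S. young_symmetrizer t s * f s) =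
    (\<Sum>s\<in>?S. \<Sum>p\<in>row_group t. \<Sum>q\<in>column_group t. if p \<circ> q = s then of_int (sign q) * f (p \<circ> q) else 0)"
    unfolding young_symmetrizer_def sum_distrib_right
    by (intro sum.cong refl) auto
  also have "\<dots> = (\<Sum>p\<in>row_group t. \<Sum>s\<in>?S. \<Sum>q\<in>column_group t. if p \<circ> q = s then of_int (sign q) * f (p \<circ> q) else 0)"
    by (rule sum.swap)
  also have "\<dots> = (\<Sum>p\<in>row_group t. \<Sum>q\<in>column_group t. \<Sum>s\<in>?S. if p \<circ> q = s then of_int (sign q) * f (p \<circ> q) else 0)"
    by (intro sum.cong refl sum.swap)
  also have "\<dots> = (\<Sum>p\<in>row_group t. \<Sum>q\<in>column_group t. of_int (sign q) * f (p \<circ> q))"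
  proof (intro sum.cong refl)
    fix p q assume "p \<in> row_group t" "q \<in> column_group t"
    hence "p \<circ> q permutes set (concat t)"
      by (intro permutes_compose column_group_permutes row_group_permutes)
    hence "p \<circ> q \<in> ?S" by (simp only: assms mem_Collect_eq)
    thus "(\<Sum>s\<in>?S. if p \<circ> q = s then of_int (sign q) * f (p \<circ> q) else 0) = of_int (sign q) * f (p \<circ> q)"
      by (simp add: finite_permutations)
  qed
  finally show ?thesis .
qed

text \<open>Inversion reverses p \<circ> q, and both groups are closed under inverses, which keep
  the sign. The net effect of \<open>star\<close> is that the column factor moves to the
  left.\<close>

lemma sum_star_young_symmetrizer:
  fixes f :: "(nat \<Rightarrow> nat) \<Rightarrow> 'k::field"
  assumes t: "set (concat t) = {1..n}"
  shows "(\<Sum>s | s permutes {1..n}. star (young_symmetrizer t) s * f s) =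
    (\<Sum>q\<in>column_group t. \<Sum>p\<in>row_group t. of_int (sign q) * f (q \<circ> p))"
proof -
  let ?S = "{s. s permutes {1..n}}"
  have b: "bij_betw inv ?S ?S"
    by (rule bij_betw_byWitness[where f' = inv]) (auto simp: permutes_inv_inv permutes_inv)
  have "(\<Sum>s\<in>?S. star (young_symmetrizer t) s * f s) = (\<Sum>s\<in>?S. young_symmetrizer t (inv s) * f s)"
    by (intro sum.cong refl) (auto simp: star_def permutes_bij)
  also have "\<dots> = (\<Sum>s\<in>?S. young_symmetrizer t s * f (inv s))"
    by (subst sum.reindex_bij_betw[OF b, symmetric]) (auto simp: permutes_inv_inv intro!: sum.cong)
  also have "\<dots> = (\<Sum>p\<in>row_group t. \<Sum>q\<in>column_group t. of_int (sign q) * f (inv (p \<circ> q)))"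
    by (rule sum_young_symmetrizer[OF t])
  also have "\<dots> = (\<Sum>q\<in>column_group t. \<Sum>p\<in>row_group t. of_int (sign q) * f (inv (p \<circ> q)))"
    by (rule sum.swap)
  also have "\<dots> = (\<Sum>q\<in>column_group t. \<Sum>p\<in>row_group t. of_int (sign (inv q)) * f (inv q \<circ> inv p))"
  proof (intro sum.cong refl)
    fix p q assume p: "p \<in> row_group t" and q: "q \<in> column_group t"
    have "permutation q"
      using column_group_permutes[OF q] by (auto simp: permutation_permutes simp del: set_concat)
    thus "of_int (sign q) * f (inv (p \<circ> q)) = of_int (sign (inv q)) * f (inv q \<circ> inv p)"
      using o_inv_distrib[OF permutes_bij permutes_bij, OF row_group_permutes[OF p] column_group_permutes[OF q]]
      by (simp add: sign_inverse)
  qed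
  also have "\<dots> = (\<Sum>q\<in>column_group t. \<Sum>p\<in>row_group t. of_int (sign q) * f (q \<circ> inv p))"
    by (rule sum.reindex_bij_betw[OF bij_inv_column_group])
  also have "\<dots> = (\<Sum>q\<in>column_group t. \<Sum>p\<in>row_group t. of_int (sign q) * f (q \<circ> p))"
    by (intro sum.cong refl sum.reindex_bij_betw[OF bij_inv_row_group])
  finally show ?thesis .
qed

lemma young_symmetrizer_in_group_ring:
  assumes "set (concat t) = {1..n}"
  shows "young_symmetrizer t \<in> group_ring n"
  unfolding group_ring_def young_symmetrizer_def
  using permutes_compose[OF column_group_permutes row_group_permutes] assms
  by (fastforce intro!: sum.neutral simp del: set_concat)

text \<open>Left multiplication by the transposition is a sign-reversing bijection of G, so the sum
  equals its own negative.\<close>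

lemma sum_sign_transpose_closed:
  assumes "finite A" "\<And>p. p \<in> G \<Longrightarrow> p permutes A" "a \<noteq> b"
    "\<And>p. p \<in> G \<Longrightarrow> transpose a b \<circ> p \<in> G"
  shows "(\<Sum>p\<in>G. of_int (sign p) :: 'k::field_char_0) = 0"
proof -
  have b: "bij_betw (\<lambda>p. transpose a b \<circ> p) G G"
    by (rule bij_betw_byWitness[where f' = "\<lambda>p. transpose a b \<circ> p"])
      (use assms(4) in \<open>auto simp: comp_assoc[symmetric]\<close>)
  have "(\<Sum>p\<in>G. of_int (sign p) :: 'k) = (\<Sum>p\<in>G. of_int (sign (transpose a b \<circ> p)))"
    by (rule sum.reindex_bij_betw[OF b, symmetric])
  also have "\<dots> = (\<Sum>p\<in>G. - of_int (sign p))"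
  proof (intro sum.cong refl)
    fix p assume "p \<in> G"
    hence "permutation p" using assms(1,2) by (auto simp: permutation_permutes)
    thus "of_int (sign (transpose a b \<circ> p)) = (- of_int (sign p) :: 'k)"
      using assms(3) by (simp add: sign_compose permutation_swap_id sign_swap_id)
  qed
  finally show ?thesis by (simp add: sum_negf)
qed

lemma tableau_of_frame_21:
  assumes "tableau_of_frame [2, 1] t"
  obtains a b c where "t = [[a, b], [c]]" "distinct [a, b, c]" "{a, b, c} = {1..3}"
proof -
  have l: "map length t = [2, 1]" and d: "distinct (concat t)" and s: "set (concat t) = {1..3}"
    using assms by (auto simp: tableau_of_frame_def)
  from l obtain u v where t: "t = [u, v]" and uv: "length u = 2" "length v = 1" by auto
  from uv obtain a b c where "u = [a, b]" "v = [c]"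
    by (auto simp: numeral_2_eq_2 length_Suc_conv)
  thus thesis using that t d s by auto
qed

lemma column_conv_UN:
  "column t j = (\<Union>i\<in>{..<length t}. if j < length (t ! i) then {t ! i ! j} else {})"
  by (auto simp: column_def split: if_splits)

lemma column_21:
  "column [[a, b], [c]] j = (if j = 0 then {a, c} else if j = 1 then {b} else {})"
  unfolding column_conv_UN by (auto simp: lessThan_Suc)

lemma row_group_compose: "p \<in> row_group t \<Longrightarrow> q \<in> row_group t \<Longrightarrow> p \<circ> q \<in> row_group t"
  unfolding row_group_def mem_Collect_eq by (metis image_comp permutes_compose)

lemma column_group_compose: "p \<in> column_group t \<Longrightarrow> q \<in> column_group t \<Longrightarrow> p \<circ> q \<in> column_group t"
  unfolding column_group_def mem_Collect_eq by (metis image_comp permutes_compose)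

text \<open>The trivial character produces the sum of signs over the column group as a factor. The
  sign character produces that of the row group, because sign q times the sign of p \<circ> q is
  sign p. Either group contains a transposition.\<close>

lemma young_symmetrizer_in_std_block:
  assumes "tableau_of_frame [2, 1] t"
  shows "(young_symmetrizer t :: ('k::field_char_0) group_ring_elt) \<in> std_block"
proof -
  obtain a b c where t: "t = [[a, b], [c]]" and d: "distinct [a, b, c]" and s: "{a, b, c} = {1..3}"
    using tableau_of_frame_21[OF assms] .
  have st: "set (concat t) = {1..3}" using t s by auto
  have row: "(\<Sum>p\<in>row_group t. of_int (sign p) :: 'k) = 0"
  proof (rule sum_sign_transpose_closed[where A = "set (concat t)"])
    fix p assume "p \<in> row_group t"
    moreover have "transpose a b \<in> row_group t"
      using d unfolding row_group_def t by (auto simp: permutes_swap_id)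
    ultimately show "transpose a b \<circ> p \<in> row_group t" by (rule row_group_compose[rotated])
  qed (use d in \<open>auto dest: row_group_permutes\<close>)
  have col: "(\<Sum>p\<in>column_group t. of_int (sign p) :: 'k) = 0"
  proof (rule sum_sign_transpose_closed[where A = "set (concat t)"])
    fix p assume "p \<in> column_group t"
    moreover have "transpose a c \<in> column_group t"
      using d unfolding column_group_def t by (auto simp: column_21 permutes_swap_id)
    ultimately show "transpose a c \<circ> p \<in> column_group t" by (rule column_group_compose[rotated])
  qed (use d in \<open>auto dest: column_group_permutes\<close>)
  show ?thesis
  proof (rule std_blockI)
    show "(young_symmetrizer t :: 'k group_ring_elt) \<in> group_ring 3"
      by (rule young_symmetrizer_in_group_ring[OF st])
    show "(\<Sum>s | s permutes {1..3}. young_symmetrizer t s :: 'k) = 0"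
      using sum_young_symmetrizer[OF st, of "\<lambda>_. 1 :: 'k"] col by simp
    have "(\<Sum>s | s permutes {1..3}. young_symmetrizer t s * of_int (sign s) :: 'k)
      = (\<Sum>p\<in>row_group t. \<Sum>q\<in>column_group t. of_int (sign p))"
      unfolding sum_young_symmetrizer[OF st]
    proof (intro sum.cong refl)
      fix p q assume "p \<in> row_group t" "q \<in> column_group t"
      hence "permutation p" "permutation q"
        using row_group_permutes column_group_permutes permutation_permutes finite_set by blast+
      thus "of_int (sign q) * of_int (sign (p \<circ> q)) = (of_int (sign p) :: 'k)"
        by (simp add: sign_compose) (simp add: sign_def)
    qed
    also have "\<dots> = 0" using row by (simp add: sum_distrib_left[symmetric])
    finally show "(\<Sum>s | s permutes {1..3}. young_symmetrizer t s * of_int (sign s) :: 'k) = 0" .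
  qed
qed

text \<open>The row group fixes 3 and the column group fixes 2, so p \<circ> q = id only for p = q =
  id, and the coefficient at the identity is 1.\<close>

lemma young_symmetrizer_12_3_nonzero:
  "young_symmetrizer [[1, 2], [3]] \<noteq> (\<lambda>_. 0 :: 'k::field_char_0)"
proof -
  let ?t = "[[1, 2], [3]] :: nat list list"
  have iff: "p \<circ> q = id \<longleftrightarrow> p = id \<and> q = id" if p: "p \<in> row_group ?t" and q: "q \<in> column_group ?t" for p q
  proof
    assume e: "p \<circ> q = id"
    have pp: "p permutes {1,2,3}" "q permutes {1,2,3}"
      using row_group_permutes[OF p] column_group_permutes[OF q] by (auto simp: insert_commute)
    have "p 3 = 3" using p by (auto simp: row_group_def)
    moreover have "q 2 = 2" using q by (auto simp: column_group_def column_21 split: if_splits dest!: spec[of _ "1::nat"])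
    moreover have "p (q i) = i" for i using e by (metis comp_apply id_apply)
    ultimately have f: "p 2 = 2" "p 3 = 3" by metis+
    moreover have "p 1 = 1"
    proof -
      have "p 1 \<in> {1,2,3}" unfolding permutes_in_image[OF pp(1)] by simp
      moreover have "p 1 \<noteq> p 2" "p 1 \<noteq> p 3" using permutes_inj[OF pp(1)] by (simp_all add: inj_eq)
      ultimately show ?thesis using f by auto
    qed
    ultimately have "p i = i" for i
      using permutes_not_in[OF pp(1), of i] by (cases "i \<in> {1,2,3}") auto
    hence "p = id" by auto
    thus "p = id \<and> q = id" using e by simp
  qed simp
  have id: "id \<in> row_group ?t" "id \<in> column_group ?t"
    by (auto simp: row_group_def column_group_def permutes_id)
  have "young_symmetrizer ?t id = (\<Sum>p\<in>row_group ?t. \<Sum>q\<in>column_group ?t.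
      if q = id then if p = id then 1 else 0 else 0 :: 'k)"
    unfolding young_symmetrizer_def by (intro sum.cong refl) (use iff in auto)
  also have "\<dots> = 1" using id by (simp add: finite_row_group finite_column_group)
  finally show ?thesis by (metis zero_neq_one)
qed

text \<open>A minimal two-sided ideal containing the symmetrizers shares a nonzero element with
  \<open>std_block\<close>; as the intersection is again two-sided, minimality puts the whole ideal
  inside the block.\<close>

lemma belongs_to_partition_21_iff:
  fixes J :: "('k::field_char_0) group_ring_elt set"
  shows "belongs_to_partition [2, 1] J \<longleftrightarrow> J \<subseteq> std_block"
proof
  assume "J \<subseteq> std_block"
  thus "belongs_to_partition [2, 1] J"
    unfolding belongs_to_partition_def using minimal_std_block young_symmetrizer_in_std_block by auto
next
  assume "belongs_to_partition [2, 1] J"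
  then obtain I where I: "minimal_two_sided_ideal 3 I"
    "\<And>t. tableau_of_frame [2, 1] t \<Longrightarrow> young_symmetrizer t \<in> I" "J \<subseteq> I"
    unfolding belongs_to_partition_def by auto
  let ?y = "young_symmetrizer [[1, 2], [3]] :: 'k group_ring_elt"
  have t: "tableau_of_frame [2, 1] [[1, 2], [3]]"
    by (auto simp: tableau_of_frame_def)
  have "two_sided_ideal 3 (I \<inter> std_block)"
    using I(1) two_sided_ideal_std_block
    unfolding minimal_two_sided_ideal_def two_sided_ideal_def right_ideal_def by auto
  moreover have "?y \<in> I \<inter> std_block" using I(2)[OF t] young_symmetrizer_in_std_block[OF t] by blast
  hence "I \<inter> std_block \<noteq> {\<lambda>_. 0}" using young_symmetrizer_12_3_nonzero by auto
  ultimately have "I \<inter> std_block = I"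
    using I(1) unfolding minimal_two_sided_ideal_def by blast
  thus "J \<subseteq> std_block" using I(3) by blast
qed

section \<open>The excluded ideal and the parameter of the remaining ones\<close>

lemma f0_eq: "f0 = mcoeff (1/3) 0 (1/6) (0 :: 'k::field_char_0)"
proof -
  have g: "(f0 :: 'k group_ring_elt) \<in> group_ring 3"
    by (auto simp: f0_def group_ring_def permutes_id permutes_swap_id)
  show ?thesis
    unfolding fun_eq_permutes_3[OF g mcoeff_in_group_ring]
    unfolding f0_def perm_of_list_3_eqs
    using sign_perm_of_list_3 by (simp add: mcoeff_def perm_of_list_inject)
qed

lemma principal_right_ideal_f0:
  "principal_right_ideal 3 f0 = line_ideal 1 (0 :: 'k::field_char_0)"
proof
  have "f0 \<in> line_ideal 1 (0::'k)"
    unfolding f0_eq by (rule line_idealI[of _ "1/3" _ _ "1/6"]) simp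
  thus "principal_right_ideal 3 f0 \<subseteq> line_ideal 1 (0::'k)"
    using right_ideal_line_ideal[of "1::'k" 0] unfolding principal_right_ideal_def right_ideal_def by blast
next
  show "line_ideal 1 (0::'k) \<subseteq> principal_right_ideal 3 f0"
  proof
    fix a assume "a \<in> line_ideal 1 (0::'k)"
    then obtain c d where a: "a = mcoeff c 0 d 0" by (auto simp: line_ideal_def)
    \<comment> \<open>Right translation by (1 2) exchanges the slots 1/3 and 1/6 of
      \<open>f0\<close>. The two coefficients u, v solve u/3 + v/6 = c and u/6 + v/3 = d.\<close>
    define b where "b = (\<lambda>s. if s = perm_of_list [1,2,3] then 4 * c - 2 * d else
      if s = perm_of_list [2,1,3] then 4 * d - 2 * c else 0)"
    have b: "b \<in> group_ring 3"
      by (auto simp: b_def group_ring_def)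
    have bv: "b (perm_of_list [1,2,3]) = 4 * c - 2 * d" "b (perm_of_list [2,1,3]) = 4 * d - 2 * c"
      "b (perm_of_list [1,3,2]) = 0" "b (perm_of_list [2,3,1]) = 0"
      "b (perm_of_list [3,1,2]) = 0" "b (perm_of_list [3,2,1]) = 0"
      unfolding b_def by (simp_all add: perm_of_list_inject)
    have "gr_mult 3 f0 b = a"
    proof
      fix s
      have m: "f0 (s \<circ> perm_of_list [2,1,3]) = mcoeff (1/6) 0 (1/3) (0::'k) s"
        using fun_cong[OF mcoeff_right_12[of "1/3" 0 "1/6" "0::'k"], of s] by (simp only: f0_eq)
      have "gr_mult 3 f0 b s = (if s permutes {1..3} then
          f0 s * (4 * c - 2 * d) + f0 (s \<circ> perm_of_list [2,1,3]) * (4 * d - 2 * c) else 0)"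
        unfolding gr_mult_conv_right sum_permutes_3 inv_perm_of_list_3 bv
        unfolding perm_of_list_3_eqs(1)[symmetric] by simp
      also have "\<dots> = mcoeff (1/3) 0 (1/6) 0 s * (4 * c - 2 * d) + mcoeff (1/6) 0 (1/3) 0 s * (4 * d - 2 * c)"
        unfolding m by (simp add: f0_eq mcoeff_def)
      also have "\<dots> = a s" unfolding a by (simp add: mcoeff_def wvec_def field_simps)
      finally show "gr_mult 3 f0 b s = a s" .
    qed
    thus "a \<in> principal_right_ideal 3 f0" using b unfolding principal_right_ideal_def by blast
  qed
qed

lemma line_ideal_eq_iff:
  fixes x x' :: "'k::field_char_0"
  shows "line_ideal x 1 = line_ideal x' 1 \<longleftrightarrow> x = x'"
  using line_ideal_subset_line_ideal[of x 1 x' 1] by auto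

lemma ideals_of_partition_21:
  "{J :: ('k::field_char_0) group_ring_elt set. minimal_right_ideal 3 J \<and>
     belongs_to_partition [2, 1] J \<and> J \<noteq> principal_right_ideal 3 f0} = range (\<lambda>x. line_ideal x 1)"
  (is "?L = ?R")
proof
  show "?L \<subseteq> ?R"
  proof
    fix J assume "J \<in> ?L"
    hence J: "minimal_right_ideal 3 J" "J \<subseteq> std_block" "J \<noteq> line_ideal 1 0"
      unfolding belongs_to_partition_21_iff principal_right_ideal_f0 by blast+
    then obtain x y where xy: "(x, y) \<noteq> (0, 0)" "J = line_ideal x y"
      using minimal_right_ideal_in_std_block by metis
    have "y \<noteq> 0"
    proof
      assume "y = 0"
      thus False using xy J(3) line_ideal_scale[of x 1 0] by simp
    qed
    hence "J = line_ideal (x / y) 1" using xy(2) line_ideal_scale[of y "x / y" 1] by simp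
    thus "J \<in> ?R" by blast
  qed
  show "?R \<subseteq> ?L"
  proof
    fix J :: "'k group_ring_elt set" assume "J \<in> ?R"
    then obtain x where J: "J = line_ideal x 1" by blast
    have "J \<noteq> line_ideal 1 0" unfolding J using line_ideal_subset_line_ideal[of x 1 1 0] by auto
    thus "J \<in> ?L"
      unfolding belongs_to_partition_21_iff principal_right_ideal_f0
      unfolding J using line_ideal_subset_std_block minimal_line_ideal[of x 1] by simp
  qed
qed

section \<open>Admissible pairs and reduction coefficients\<close>

text \<open>The determinant of the vectors p w and q w, where w = (x, y, -x-y).\<close>

definition rdet :: "'k::field \<Rightarrow> 'k \<Rightarrow> (nat \<Rightarrow> nat) \<Rightarrow> (nat \<Rightarrow> nat) \<Rightarrow> 'k" where
  "rdet x y p q = wvec x y (inv p 1) * wvec x y (inv q 2) - wvec x y (inv q 1) * wvec x y (inv p 2)"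

lemma rdet_self [simp]: "rdet x y p p = 0"
  by (simp add: rdet_def)

lemma rdet_swap: "rdet x y q p = - rdet x y p q"
  by (simp add: rdet_def)

lemma wvec_scale: "wvec (c * x) (c * y) i = c * wvec x y i"
  by (simp add: wvec_def algebra_simps)

lemma permutes_inv_iff:
  assumes "bij s"
  shows "inv s permutes A \<longleftrightarrow> s permutes A"
  using permutes_inv[of s A] permutes_inv[of "inv s" A] inv_inv_eq[OF assms] by auto

lemma star_line_ideal:
  defines "h \<equiv> \<lambda>x y i s. if s permutes {1..3::nat} then wvec x (y::'k::field) (inv s i) else 0"
  shows "star ` line_ideal x y = {\<lambda>s. c * h x y 1 s + d * h x y 2 s | c d. True}"
proof -
  have "star (mcoeff (c * x) (c * y) (d * x) (d * y)) = (\<lambda>s. c * h x y 1 s + d * h x y 2 s)" for c d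
  proof
    fix s show "star (mcoeff (c * x) (c * y) (d * x) (d * y)) s = c * h x y 1 s + d * h x y 2 s"
    proof (cases "bij s")
      case True
      thus ?thesis by (simp add: star_def mcoeff_def h_def permutes_inv_iff wvec_scale)
    next
      case False
      thus ?thesis using permutes_bij[of s] by (auto simp: star_def h_def)
    qed
  qed
  moreover have "star ` line_ideal x y = {star (mcoeff (c * x) (c * y) (d * x) (d * y)) | c d. True}"
    unfolding line_ideal_def by blast
  ultimately show ?thesis by simp
qed

text \<open>Replacing the coordinate functions s \<mapsto> (s w) i, i = 1, 2, by other elements of
  their span multiplies the 2x2 determinant by that of the coefficients. A nonzero
  \<open>rdet\<close> in turn makes the coordinate functions themselves a basis.\<close>

lemma admissible_line_ideal_iff:
  "admissible (line_ideal x y) P \<longleftrightarrow>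
    (\<exists>p q. P = {p, q} \<and> p permutes {1..3} \<and> q permutes {1..3} \<and> rdet x y p q \<noteq> 0)"
    (is "?L \<longleftrightarrow> ?R")
proof -
  define h where "h i s = (if s permutes {1..3::nat} then wvec x y (inv s i) else 0)" for i s
  have star: "star ` line_ideal x y = {\<lambda>s. c * h 1 s + d * h 2 s | c d. True}"
    unfolding star_line_ideal h_def ..
  have det: "rdet x y p q = h 1 p * h 2 q - h 1 q * h 2 p"
    if "p permutes {1..3}" "q permutes {1..3}" for p q
    using that by (simp add: rdet_def h_def)
  show ?thesis
  proof
    assume ?L
    then obtain p q h1 h2 where P: "P = {p, q}" "p permutes {1..3}" "q permutes {1..3}"
      and b: "is_basis2 (star ` line_ideal x y) h1 h2" and nz: "h1 p * h2 q - h1 q * h2 p \<noteq> 0"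
      unfolding admissible_def by blast
    have "(\<lambda>p. 1 * h1 p + 0 * h2 p) \<in> star ` line_ideal x y" "(\<lambda>p. 0 * h1 p + 1 * h2 p) \<in> star ` line_ideal x y"
      using b unfolding is_basis2_def by blast+
    then obtain c d c' d' where e: "h1 = (\<lambda>s. c * h 1 s + d * h 2 s)" "h2 = (\<lambda>s. c' * h 1 s + d' * h 2 s)"
      unfolding star by auto
    have "h1 p * h2 q - h1 q * h2 p = (c * d' - d * c') * rdet x y p q"
      unfolding det[OF P(2,3)] e by (simp add: algebra_simps)
    hence "rdet x y p q \<noteq> 0" using nz by auto
    thus ?R using P by blast
  next
    assume ?R
    then obtain p q where P: "P = {p, q}" "p permutes {1..3}" "q permutes {1..3}" and nz: "rdet x y p q \<noteq> 0"
      by blast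
    have "c = 0 \<and> d = 0" if "\<forall>s. c * h 1 s + d * h 2 s = 0" for c d
    proof -
      have e: "c * h 1 p + d * h 2 p = 0" "c * h 1 q + d * h 2 q = 0" using that by blast+
      have "c * rdet x y p q = h 2 q * (c * h 1 p + d * h 2 p) - h 2 p * (c * h 1 q + d * h 2 q)"
        "d * rdet x y p q = h 1 p * (c * h 1 q + d * h 2 q) - h 1 q * (c * h 1 p + d * h 2 p)"
        unfolding det[OF P(2,3)] by (simp_all add: algebra_simps)
      thus ?thesis unfolding e using nz by simp
    qed
    hence "is_basis2 (star ` line_ideal x y) (h 1) (h 2)"
      unfolding is_basis2_def star by blast
    moreover have "p \<noteq> q" using nz by auto
    ultimately show ?L
      unfolding admissible_def using P nz det[OF P(2,3)] by metis
  qed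
qed

text \<open>Substituting s \<circ> p for p moves the permutation of the arguments onto the
  coefficients as a left translation.\<close>

lemma gr_act_comp:
  fixes a :: "('k::field) group_ring_elt"
  assumes s: "s permutes {1..r}"
  shows "gr_act r a T (v \<circ> s) = (\<Sum>p | p permutes {1..r}. a (inv s \<circ> p) * T (v \<circ> p))"
proof -
  let ?S = "{p. p permutes {1..r}}"
  have b: "bij_betw (\<lambda>p. s \<circ> p) ?S ?S"
    by (rule bij_betw_byWitness[where f' = "\<lambda>p. inv s \<circ> p"])
      (use s permutes_inv[OF s] in \<open>auto simp: permutes_comp_left_iff comp_assoc[symmetric] permutes_inv_o\<close>)
  have "(\<Sum>p\<in>?S. a (inv s \<circ> p) * T (v \<circ> p)) = (\<Sum>p\<in>?S. a (inv s \<circ> (s \<circ> p)) * T (v \<circ> (s \<circ> p)))"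
    by (rule sum.reindex_bij_betw[OF b, symmetric])
  also have "\<dots> = gr_act r a T (v \<circ> s)"
    unfolding gr_act_def by (simp only: comp_assoc[symmetric] permutes_inv_o[OF s] id_comp)
  finally show ?thesis by simp
qed

text \<open>The coefficients of a permuted tensor depend linearly on the vector s w, so a linear
  relation between such vectors passes to every tensor of the class. Two coordinates suffice, since
  the third is minus their sum.\<close>

lemma symmetry_class_relationI:
  fixes c :: "(nat \<Rightarrow> nat) \<Rightarrow> 'k::field"
  assumes U: "U \<in> symmetry_class scale 3 (line_ideal x y)"
    and s: "s permutes {1..3}" and Q: "\<And>q. q \<in> Q \<Longrightarrow> q permutes {1..3}"
    and rel: "\<And>j. j \<in> {1, 2} \<Longrightarrow> wvec x y (inv s j) = (\<Sum>q\<in>Q. c q * wvec x y (inv q j))"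
  shows "U (v \<circ> s) = (\<Sum>q\<in>Q. c q * U (v \<circ> q))"
proof -
  obtain d e T where U: "U = gr_act 3 (mcoeff (d * x) (d * y) (e * x) (e * y)) T"
    using U unfolding symmetry_class_def line_ideal_def by blast
  let ?a = "mcoeff (d * x) (d * y) (e * x) (e * y)"
  have rel3: "wvec x y (inv s j) = (\<Sum>q\<in>Q. c q * wvec x y (inv q j))" if "j \<in> {1..3}" for j
  proof -
    have "j = 1 \<or> j = 2 \<or> j = 3" using that by auto
    then consider "j \<in> {1, 2}" | "j = 3" by blast
    thus ?thesis
    proof cases
      case 2
      have "wvec x y (inv s 3) = - wvec x y (inv s 1) - wvec x y (inv s 2)"
        by (rule sum_wvec_permutes[OF permutes_inv[OF s]])
      also have "\<dots> = (\<Sum>q\<in>Q. c q * (- wvec x y (inv q 1) - wvec x y (inv q 2)))"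
        unfolding rel[of 1, OF insertI1] rel[of 2, OF insertI2[OF singletonI]]
        by (simp add: sum_negf sum_subtractf algebra_simps)
      also have "\<dots> = (\<Sum>q\<in>Q. c q * wvec x y (inv q 3))"
        by (intro sum.cong refl) (simp only: sum_wvec_permutes[OF permutes_inv[OF Q]])
      finally show ?thesis using 2 by simp
    qed (rule rel)
  qed
  have a: "?a (inv s \<circ> p) = (\<Sum>q\<in>Q. c q * ?a (inv q \<circ> p))" if p: "p permutes {1..3}" for p
  proof -
    have iv: "p 1 \<in> {1..3}" "p 2 \<in> {1..3}" unfolding permutes_in_image[OF p] by auto
    have m: "?a (inv q \<circ> p) = d * wvec x y (inv q (p 1)) + e * wvec x y (inv q (p 2))"
      if "q permutes {1..3}" for q
      using permutes_comp_left_iff[OF permutes_inv[OF that]] p by (simp add: mcoeff_def wvec_scale)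
    have "?a (inv s \<circ> p) = (\<Sum>q\<in>Q. c q * (d * wvec x y (inv q (p 1)) + e * wvec x y (inv q (p 2))))"
      unfolding m[OF s] rel3[OF iv(1)] rel3[OF iv(2)]
      by (simp add: sum_distrib_left sum.distrib algebra_simps)
    also have "\<dots> = (\<Sum>q\<in>Q. c q * ?a (inv q \<circ> p))" using m[OF Q] by (intro sum.cong) auto
    finally show ?thesis .
  qed
  have "U (v \<circ> s) = (\<Sum>p | p permutes {1..3}. \<Sum>q\<in>Q. c q * (?a (inv q \<circ> p) * T (v \<circ> p)))"
    unfolding U gr_act_comp[OF s] by (intro sum.cong refl) (simp add: a sum_distrib_right mult.assoc)
  also have "\<dots> = (\<Sum>q\<in>Q. \<Sum>p | p permutes {1..3}. c q * (?a (inv q \<circ> p) * T (v \<circ> p)))"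
    by (rule sum.swap)
  also have "\<dots> = (\<Sum>q\<in>Q. c q * U (v \<circ> q))"
    unfolding U by (intro sum.cong refl) (simp add: gr_act_comp[OF Q] sum_distrib_left)
  finally show ?thesis .
qed

text \<open>Dimension at least 3 provides three different basis vectors; the product of their dual
  functionals, evaluated at a permuted triple of them, detects the identity.\<close>

lemma separating_tensor:
  fixes scale :: "'k::field \<Rightarrow> 'v::ab_group_add \<Rightarrow> 'v"
  assumes V: "finite_dimensional_vector_space scale Basis"
    and dim: "vector_space.dim scale (UNIV :: 'v set) \<ge> 3"
  obtains T v where "T \<in> tensors scale 3"
    "\<And>p. p permutes {1..3} \<Longrightarrow> T (v \<circ> p) = (if p = id then 1 else 0 :: 'k)"
proof -
  interpret finite_dimensional_vector_space scale Basis by (rule V)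
  have "card Basis \<ge> 3" using dim by simp
  then obtain B where B: "B \<subseteq> Basis" "card B = 3" by (meson obtain_subset_with_card_n)
  then obtain b1 b2 b3 where b: "b1 \<in> Basis" "b2 \<in> Basis" "b3 \<in> Basis" "b1 \<noteq> b2" "b1 \<noteq> b3" "b2 \<noteq> b3"
    by (auto simp: card_3_iff)
  let ?f = "\<lambda>b v. representation Basis v b"
  define T where "T v = ?f b1 (v 1) * ?f b2 (v 2) * ?f b3 (v 3)" for v :: "nat \<Rightarrow> 'v"
  define v where "v = (\<lambda>i::nat. if i = 1 then b1 else if i = 2 then b2 else b3)"
  have f: "?f b u = (if b = u then 1 else 0)" if "u \<in> Basis" for b u
    using representation_basis[OF independent_Basis that] by simp
  have lin: "Vector_Spaces.linear scale (*) g"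
    if "\<And>u w. g (u + w) = g u + g w" "\<And>c u. g (scale c u) = c * g u" for g :: "'v \<Rightarrow> 'k"
    unfolding Vector_Spaces.linear_def module_hom_iff using that vector_space_axioms module_axioms
    by (auto simp: vector_space_def module_def algebra_simps)
  have add: "?f b (u + w) = ?f b u + ?f b w" for b u w
    by (simp add: representation_add independent_Basis span_Basis)
  have sc: "?f b (scale c u) = c * ?f b u" for b c u
    by (simp add: representation_scale independent_Basis span_Basis)
  have T: "T \<in> tensors scale 3"
    unfolding tensors_def
  proof (intro CollectI conjI allI ballI impI)
    show "T v = T v'" if "\<forall>i\<in>{1..3}. v i = v' i" for v v' using that by (simp add: T_def)
    fix i :: nat and u assume "i \<in> {1..3}"
    hence "i = 1 \<or> i = 2 \<or> i = 3" by auto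
    thus "Vector_Spaces.linear scale (*) (\<lambda>x. T (u(i := x)))"
      by (intro lin) (auto simp: T_def add sc algebra_simps)
  qed
  have "\<forall>p. p permutes {1..3} \<longrightarrow> T (v \<circ> p) = (if p = perm_of_list [1,2,3] then 1 else 0)"
    unfolding all_permutes_3 using b by (simp add: T_def v_def f perm_of_list_inject)
  thus thesis using that[OF T, of v] by (simp add: perm_of_list_3_eqs(1))
qed

text \<open>At the separating tensor T, the value of a T at v \<circ> p is a (inv p). An identity
  valid on the class thus holds for each coefficient function, in particular for the two coordinates
  of w.\<close>

lemma symmetry_class_relationD:
  fixes scale :: "'k::field \<Rightarrow> 'v::ab_group_add \<Rightarrow> 'v"
  assumes V: "finite_dimensional_vector_space scale Basis"
    and dim: "vector_space.dim scale (UNIV :: 'v set) \<ge> 3"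
    and s: "s permutes {1..3}" and Q: "\<And>q. q \<in> Q \<Longrightarrow> q permutes {1..3}"
    and rel: "\<And>U v. U \<in> symmetry_class scale 3 (line_ideal x y) \<Longrightarrow>
      U (v \<circ> s) = (\<Sum>q\<in>Q. c q * U (v \<circ> q))"
    and j: "j \<in> {1, 2}"
  shows "wvec x y (inv s j) = (\<Sum>q\<in>Q. c q * wvec x y (inv q j))"
proof -
  obtain T v where T: "T \<in> tensors scale 3"
    and v: "\<And>p. p permutes {1..3} \<Longrightarrow> T (v \<circ> p) = (if p = id then 1 else 0 :: 'k)"
    using separating_tensor[OF V dim] by blast
  have eval: "gr_act 3 a T (v \<circ> p) = a (inv p)" if p: "p permutes {1..3}" for p a
  proof -
    have "gr_act 3 a T (v \<circ> p) = (\<Sum>q | q permutes {1..3::nat}. if q = id then a (inv p) else 0)"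
      unfolding gr_act_comp[OF p] by (intro sum.cong refl) (auto simp: v)
    thus ?thesis by (simp add: finite_permutations permutes_id)
  qed
  define a where "a = (if j = 1 then mcoeff x y 0 0 else mcoeff 0 0 x y)"
  have "a \<in> line_ideal x y"
    using line_idealI[of "mcoeff x y 0 0" 1 x y 0] line_idealI[of "mcoeff 0 0 x y" 0 x y 1] by (simp add: a_def)
  hence "gr_act 3 a T \<in> symmetry_class scale 3 (line_ideal x y)"
    using T unfolding symmetry_class_def by blast
  from rel[OF this, of v] have "a (inv s) = (\<Sum>q\<in>Q. c q * a (inv q))"
    using eval s Q by simp
  moreover have "a (inv q) = wvec x y (inv q j)" if "q permutes {1..3}" for q
    using permutes_inv[OF that] j by (auto simp: a_def mcoeff_def wvec_def)
  ultimately show ?thesis using s Q by simp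
qed

lemma cramer2:
  fixes a1 a2 b1 b2 :: "'k::field"
  assumes "a1 * b2 - b1 * a2 \<noteq> 0"
  shows "A * a1 + B * b1 = c1 \<and> A * a2 + B * b2 = c2 \<longleftrightarrow>
    A = (c1 * b2 - b1 * c2) / (a1 * b2 - b1 * a2) \<and> B = (a1 * c2 - c1 * a2) / (a1 * b2 - b1 * a2)"
    (is "?L \<longleftrightarrow> ?R")
proof
  assume ?L
  hence "c1 = A * a1 + B * b1" "c2 = A * a2 + B * b2" by auto
  thus ?R using assms by (auto simp: nonzero_eq_divide_eq algebra_simps)
next
  let ?D = "a1 * b2 - b1 * a2"
  assume R: ?R
  have "(c1 * b2 - b1 * c2) * a1 + (a1 * c2 - c1 * a2) * b1 = c1 * ?D"
    "(c1 * b2 - b1 * c2) * a2 + (a1 * c2 - c1 * a2) * b2 = c2 * ?D"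
    by (simp_all add: algebra_simps)
  moreover have "A * u + B * w = ((c1 * b2 - b1 * c2) * u + (a1 * c2 - c1 * a2) * w) / ?D" for u w
    using R by (simp add: add_divide_distrib)
  ultimately show ?L using assms by simp
qed

text \<open>The identities sought are equivalent to a 2x2 linear system with determinant
  \<open>rdet x y p q\<close>. Cramer's rule yields existence and uniqueness together, as the
  definite description requires. For s in the pair the same quotients are 1 and 0, in agreement with
  the separate clause of \<open>reduction_coeff\<close>.\<close>

lemma reduction_coeff_line_ideal:
  fixes scale :: "'k::field \<Rightarrow> 'v::ab_group_add \<Rightarrow> 'v"
  assumes V: "finite_dimensional_vector_space scale Basis"
    and dim: "vector_space.dim scale (UNIV :: 'v set) \<ge> 3"
    and p: "p permutes {1..3}" and q: "q permutes {1..3}" and nz: "rdet x y p q \<noteq> 0"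
    and s: "s permutes {1..3}"
  shows "reduction_coeff scale (line_ideal x y) {p, q} s p = rdet x y s q / rdet x y p q"
    "reduction_coeff scale (line_ideal x y) {p, q} s q = rdet x y p s / rdet x y p q"
proof -
  have pq: "p \<noteq> q" using nz by auto
  define c where "c r = (if r = p then rdet x y s q / rdet x y p q
    else if r = q then rdet x y p s / rdet x y p q else 0)" for r
  have iff: "(\<forall>U\<in>symmetry_class scale 3 (line_ideal x y). \<forall>v.
      U (v \<circ> s) = (\<Sum>r\<in>{p, q}. e r * U (v \<circ> r))) \<longleftrightarrow> e p = c p \<and> e q = c q" (is "?L \<longleftrightarrow> ?R") for e
  proof -
    have "?L \<longleftrightarrow> (\<forall>j\<in>{1, 2}. wvec x y (inv s j) = (\<Sum>r\<in>{p, q}. e r * wvec x y (inv r j)))"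
      (is "_ \<longleftrightarrow> ?M")
    proof
      assume ?L
      thus ?M using symmetry_class_relationD[OF V dim s, of "{p, q}" x y e] p q by blast
    next
      assume M: ?M
      have Q: "r permutes {1..3}" if "r \<in> {p, q}" for r using that p q by blast
      show ?L
        using symmetry_class_relationI[OF _ s Q, where c = e] M by blast
    qed
    also have "\<dots> \<longleftrightarrow> e p * wvec x y (inv p 1) + e q * wvec x y (inv q 1) = wvec x y (inv s 1) \<and>
        e p * wvec x y (inv p 2) + e q * wvec x y (inv q 2) = wvec x y (inv s 2)"
      using pq by auto
    also have "\<dots> \<longleftrightarrow> ?R"
      using cramer2[of "wvec x y (inv p 1)" "wvec x y (inv q 2)" "wvec x y (inv q 1)" "wvec x y (inv p 2)"] nz pq
      unfolding c_def rdet_def by simp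
    finally show ?thesis .
  qed
  have "reduction_coeff scale (line_ideal x y) {p, q} s r = c r" if "r \<in> {p, q}" for r
  proof (cases "s \<in> {p, q}")
    case True
    thus ?thesis using pq nz that by (auto simp: reduction_coeff_def c_def)
  next
    case False
    have "(THE e. (\<forall>r. r \<notin> {p, q} \<longrightarrow> e r = 0) \<and>
        (\<forall>U\<in>symmetry_class scale 3 (line_ideal x y). \<forall>v.
          U (v \<circ> s) = (\<Sum>r\<in>{p, q}. e r * U (v \<circ> r)))) = c"
      unfolding iff
    proof (rule the_equality)
      show "(\<forall>r. r \<notin> {p, q} \<longrightarrow> c r = 0) \<and> c p = c p \<and> c q = c q" by (auto simp: c_def)
      show "e = c" if "(\<forall>r. r \<notin> {p, q} \<longrightarrow> e r = 0) \<and> e p = c p \<and> e q = c q" for e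
      proof
        fix r show "e r = c r" using that by (cases "r \<in> {p, q}") (auto simp: c_def)
      qed
    qed
    thus ?thesis using False by (simp add: reduction_coeff_def)
  qed
  from this[of p] this[of q] show
    "reduction_coeff scale (line_ideal x y) {p, q} s p = rdet x y s q / rdet x y p q"
    "reduction_coeff scale (line_ideal x y) {p, q} s q = rdet x y p s / rdet x y p q"
    using pq by (simp_all add: c_def)
qed

lemma index_commutation_symmetryI:
  assumes "p permutes {1..3}" "p \<noteq> id" "m > 0" "\<epsilon> ^ m = 1"
    "\<And>j. j \<in> {1, 2} \<Longrightarrow> wvec x y (inv p j) = \<epsilon> * wvec x y j"
  shows "index_commutation_symmetry scale (line_ideal x y)"
  unfolding index_commutation_symmetry_def
proof (intro exI conjI ballI allI)
  fix U v assume "U \<in> symmetry_class scale 3 (line_ideal x y)"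
  from symmetry_class_relationI[OF this assms(1), of "{id}" "\<lambda>_. \<epsilon>" v] assms(5)
  show "U (v \<circ> p) = \<epsilon> * U v" by (simp add: permutes_id)
qed (use assms in auto)

section \<open>Expansion of the Young symmetrizers\<close>

text \<open>The three combinations of coordinates that span those occurring in the expansions.\<close>

definition lform :: "'k::field \<times> 'k \<times> 'k \<Rightarrow> ((nat \<Rightarrow> nat) \<Rightarrow> 'k) \<Rightarrow> 'k" where
  "lform \<kappa> g = (case \<kappa> of (a, b, c) \<Rightarrow>
     a * (g (perm_of_list [1,2,3]) - g (perm_of_list [2,1,3]) +
          g (perm_of_list [3,2,1]) - g (perm_of_list [3,1,2])) +
     b * (g (perm_of_list [1,3,2]) - g (perm_of_list [1,2,3]) +
          g (perm_of_list [2,3,1]) - g (perm_of_list [3,2,1])) +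
     c * (g (perm_of_list [1,2,3]) + g (perm_of_list [3,2,1]) +
          g (perm_of_list [2,1,3]) + g (perm_of_list [3,1,2])))"

text \<open>A pair of a list D and a triple \<open>\<kappa>\<close> means that the terms in which U has the indices D
  add up to \<open>lform \<kappa>\<close> of the coordinates of U.  Index sets with zero sum are omitted.\<close>

definition table_w :: "(nat list \<times> 'k::field \<times> 'k \<times> 'k) list" where
  "table_w = [([1,2,3], 1, 0, 0), ([1,2,4], -1, 0, 0), ([1,3,4], 0, 1, 0), ([2,3,4], 0, -1, 0)]"

definition table_S :: "(nat list \<times> 'k::field \<times> 'k \<times> 'k) list" where
  "table_S = table_w @ [([1,3,5], 0, 0, -1), ([1,4,5], 0, 0, 1), ([2,3,5], 0, 0, 1), ([2,4,5], 0, 0, -1)]"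

definition table_A :: "(nat list \<times> 'k::field \<times> 'k \<times> 'k) list" where
  "table_A = table_w @ [([1,2,5], -2, 0, 0), ([1,3,5], -1, 0, 0), ([1,4,5], 1, 0, 0),
     ([2,3,5], 1, 0, 0), ([2,4,5], -1, 0, 0), ([3,4,5], -2, 0, 0)]"

section \<open>Sums over the group in one-line notation\<close>

definition ranks :: "nat list \<Rightarrow> nat list" where
  "ranks u = map (\<lambda>x. length (filter (\<lambda>y. y \<le> x) u)) u"

text \<open>Each entry counts itself among the entries below or equal to it, so the ranks start at 1
  and form a one-line notation. Unlike the cardinality, the list form evaluates by
  rewriting.\<close>

lemma pattern3_conv: "pattern3 p = perm_of_list (ranks [p 1, p 2, p 3])"
proof
  fix i
  have iv: "{1..3} = {1,2,3::nat}" by auto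
  have c: "card {j \<in> {1..3}. p j \<le> x} = length (filter (\<lambda>y. y \<le> x) [p 1, p 2, p 3])" for x
  proof -
    have "card {j \<in> {1..3}. p j \<le> x} = (\<Sum>j\<in>{1,2,3}. if p j \<le> x then 1 else 0)"
      unfolding iv by (simp add: sum.If_cases Int_def del: sum.insert)
    thus ?thesis by simp
  qed
  show "pattern3 p i = perm_of_list (ranks [p 1, p 2, p 3]) i"
  proof (cases "i \<in> {1..3}")
    case True
    hence "i = 1 \<or> i = 2 \<or> i = 3" by auto
    thus ?thesis unfolding pattern3_def c by (auto simp: ranks_def)
  next
    case False
    thus ?thesis by (auto simp: pattern3_def perm_of_list_def ranks_def)
  qed
qed

lemma perm_of_list_take_drop:
  assumes "length l = n" "n \<ge> 3"
  shows "map (perm_of_list l) [1, 2, 3] = take 3 l"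
    "map (perm_of_list l) [4..<Suc n] = drop 3 l"
proof -
  have m: "map (perm_of_list l) [1..<Suc n] = l" using map_perm_of_list[of l] assms(1) by simp
  have "take 3 l = map (perm_of_list l) (take 3 [1..<Suc n])" using m take_map by metis
  also have "take 3 [1..<Suc n] = [1, 2, 3]"
    using assms(2) by (subst take_upt) (simp_all add: upt_rec)
  finally show "map (perm_of_list l) [1, 2, 3] = take 3 l" ..
  have "drop 3 l = map (perm_of_list l) (drop 3 [1..<Suc n])" using m drop_map by metis
  also have "drop 3 [1..<Suc n] = [4..<Suc n]" by (simp add: drop_upt del: upt_Suc)
  finally show "map (perm_of_list l) [4..<Suc n] = drop 3 l" ..
qed

text \<open>The summand of a single permutation as a function of its one-line notation l, with
  \<open>H\<close> standing for an arbitrary function of index set and pattern of U.\<close>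

definition contribution :: "'k::field \<Rightarrow> (nat list \<Rightarrow> (nat \<Rightarrow> nat) \<Rightarrow> 'k) \<Rightarrow> nat list \<Rightarrow> 'k" where
  "contribution \<sigma> H l =
    (if sorted (drop 3 l) then 1 else \<sigma>) * H (sort (take 3 l)) (perm_of_list (ranks (take 3 l)))"

lemma contribution_conv:
  assumes p: "p permutes {1..n}" and n: "n \<ge> 3"
  shows "(if sorted (map p [4..<Suc n]) then 1 else \<sigma>) *
      H (sorted_list_of_set (p ` {1..3})) (pattern3 p) = contribution \<sigma> H (map p [1..<Suc n])"
proof -
  let ?l = "map p [1..<Suc n]"
  have p': "perm_of_list ?l = p" by (rule perm_of_list_map[OF p])
  have l: "length ?l = n" by simp
  have 1: "[p 1, p 2, p 3] = take 3 ?l" and 2: "map p [4..<Suc n] = drop 3 ?l"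
    using perm_of_list_take_drop[OF l n] unfolding p' by simp_all
  have iv: "{1..3} = {1,2,3::nat}" by auto
  have "distinct [p 1, p 2, p 3]" using permutes_inj[OF p] by (simp add: inj_eq)
  hence "sorted_list_of_set (set [p 1, p 2, p 3]) = sort [p 1, p 2, p 3]"
    by (metis sorted_list_of_set_sort_remdups distinct_remdups_id)
  moreover have "p ` {1..3} = set [p 1, p 2, p 3]" unfolding iv by simp
  ultimately have "sorted_list_of_set (p ` {1..3}) = sort (take 3 ?l)" unfolding 1 by simp
  thus ?thesis unfolding contribution_def pattern3_conv 1 2 by simp
qed

text \<open>The one-line notation of q \<circ> p is \<open>map q\<close> applied to that of p. The
  sum is thereby reduced to an explicit list for the row group and the elements of the column
  group.\<close>

lemma sum_star_young_contribution:
  assumes t: "set (concat t) = {1..n}" and n: "n \<ge> 3"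
    and row: "row_group t = perm_of_list ` set L" and L: "distinct L" "\<forall>l\<in>set L. length l = n"
  shows "(\<Sum>p | p permutes {1..n}. star (young_symmetrizer t) p *
      ((if sorted (map p [4..<Suc n]) then 1 else \<sigma>) *
       H (sorted_list_of_set (p ` {1..3})) (pattern3 p))) =
    (\<Sum>q\<in>column_group t. of_int (sign q) * (\<Sum>l\<leftarrow>L. contribution \<sigma> H (map q l)))"
proof -
  have "(\<Sum>p | p permutes {1..n}. star (young_symmetrizer t) p *
      ((if sorted (map p [4..<Suc n]) then 1 else \<sigma>) *
       H (sorted_list_of_set (p ` {1..3})) (pattern3 p))) =
    (\<Sum>p | p permutes {1..n}. star (young_symmetrizer t) p * contribution \<sigma> H (map p [1..<Suc n]))"
    by (intro sum.cong refl) (simp only: mem_Collect_eq contribution_conv[OF _ n])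
  also have "\<dots> = (\<Sum>q\<in>column_group t. \<Sum>p\<in>row_group t.
      of_int (sign q) * contribution \<sigma> H (map (q \<circ> p) [1..<Suc n]))"
    by (rule sum_star_young_symmetrizer[OF t])
  also have "\<dots> = (\<Sum>q\<in>column_group t. of_int (sign q) * (\<Sum>l\<leftarrow>L. contribution \<sigma> H (map q l)))"
  proof (intro sum.cong refl)
    fix q
    have inj: "inj_on perm_of_list (set L)"
      by (intro inj_onI) (simp add: L(2) perm_of_list_inject)
    have "(\<Sum>p\<in>row_group t. of_int (sign q) * contribution \<sigma> H (map (q \<circ> p) [1..<Suc n])) =
      (\<Sum>l\<in>set L. of_int (sign q) * contribution \<sigma> H (map (q \<circ> perm_of_list l) [1..<Suc n]))"
      unfolding row by (simp add: sum.reindex[OF inj] del: upt_Suc)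
    also have "\<dots> = (\<Sum>l\<in>set L. of_int (sign q) * contribution \<sigma> H (map q l))"
    proof (intro sum.cong refl)
      fix l assume "l \<in> set L"
      hence "map (perm_of_list l) [1..<Suc n] = l" using L(2) map_perm_of_list by metis
      hence "map (q \<circ> perm_of_list l) [1..<Suc n] = map q l" by (metis map_map)
      thus "of_int (sign q) * contribution \<sigma> H (map (q \<circ> perm_of_list l) [1..<Suc n]) =
        of_int (sign q) * contribution \<sigma> H (map q l)" by simp
    qed
    finally show "(\<Sum>p\<in>row_group t. of_int (sign q) * contribution \<sigma> H (map (q \<circ> p) [1..<Suc n])) =
      of_int (sign q) * (\<Sum>l\<leftarrow>L. contribution \<sigma> H (map q l))"
      by (simp add: sum_distrib_left[symmetric] sum.distinct_set_conv_list[OF L(1)])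
  qed
  finally show ?thesis .
qed

section \<open>Row and column groups of the two tableaux\<close>

definition rows_4 :: "nat list list" where
  "rows_4 = [[1,2,3,4],[3,2,1,4],[1,4,3,2],[3,4,1,2]]"

definition rows_5 :: "nat list list" where
  "rows_5 = [[1,2,3,4,5],[1,2,5,4,3],[3,2,1,4,5],[3,2,5,4,1],[5,2,1,4,3],[5,2,3,4,1],
     [1,4,3,2,5],[1,4,5,2,3],[3,4,1,2,5],[3,4,5,2,1],[5,4,1,2,3],[5,4,3,2,1]]"

lemma image_in: "p ` A = A \<Longrightarrow> x \<in> A \<Longrightarrow> p x \<in> A"
  by blast

lemma row_group_4: "row_group [[1, 3], [2, 4]] = perm_of_list ` set rows_4"
proof (intro equalityI subsetI)
  have iv: "set (concat [[1, 3], [2, 4]]) = {1..4::nat}" by auto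
  {
    fix p assume "p \<in> row_group [[1, 3], [2, 4]]"
    hence p: "p permutes {1..4}" and i: "p ` {1, 3} = {1, 3}" "p ` {2, 4} = {2, 4}"
      unfolding row_group_def iv by simp_all
    have "p 1 \<in> {1, 3}" "p 3 \<in> {1, 3}" "p 2 \<in> {2, 4}" "p 4 \<in> {2, 4}"
      by (rule image_in[OF i(1)] image_in[OF i(2)], simp)+
    moreover have "p 1 \<noteq> p 3" "p 2 \<noteq> p 4"
      using permutes_inj[OF p] by (simp_all add: inj_eq)
    ultimately have "[p 1, p 2, p 3, p 4] \<in> set rows_4"
      unfolding rows_4_def by (elim insertE emptyE) simp_all
    moreover have "map p [1..<Suc 4] = [p 1, p 2, p 3, p 4]"
      by (simp add: upt_rec numeral_eq_Suc)
    ultimately show "p \<in> perm_of_list ` set rows_4" using perm_of_list_map[OF p] by (metis imageI)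
  next
    fix p assume "p \<in> perm_of_list ` set rows_4"
    then obtain l where l: "l \<in> set rows_4" "p = perm_of_list l" by blast
    hence "distinct l" "set l = {1..4}" unfolding iv[symmetric] rows_4_def by auto
    hence "p permutes {1..4}" using perm_of_list_permutes l(2) by blast
    moreover have "p ` {1, 3} = {1, 3}" "p ` {2, 4} = {2, 4}"
      using l by (auto simp: rows_4_def perm_of_list_def)
    ultimately show "p \<in> row_group [[1, 3], [2, 4]]"
      unfolding row_group_def iv by simp
  }
qed

lemma row_group_5: "row_group [[1, 3, 5], [2, 4]] = perm_of_list ` set rows_5"
proof (intro equalityI subsetI)
  have iv: "set (concat [[1, 3, 5], [2, 4]]) = {1..5::nat}" by auto
  {
    fix p assume "p \<in> row_group [[1, 3, 5], [2, 4]]"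
    hence p: "p permutes {1..5}" and i: "p ` {1, 3, 5} = {1, 3, 5}" "p ` {2, 4} = {2, 4}"
      unfolding row_group_def iv by simp_all
    have "p 1 \<in> {1, 3, 5}" "p 3 \<in> {1, 3, 5}" "p 5 \<in> {1, 3, 5}" "p 2 \<in> {2, 4}" "p 4 \<in> {2, 4}"
      by (rule image_in[OF i(1)] image_in[OF i(2)], simp)+
    moreover have "p 1 \<noteq> p 3" "p 1 \<noteq> p 5" "p 3 \<noteq> p 5" "p 2 \<noteq> p 4"
      using permutes_inj[OF p] by (simp_all add: inj_eq)
    ultimately have "[p 1, p 2, p 3, p 4, p 5] \<in> set rows_5"
      unfolding rows_5_def by (elim insertE emptyE) simp_all
    moreover have "map p [1..<Suc 5] = [p 1, p 2, p 3, p 4, p 5]"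
      by (simp add: upt_rec numeral_eq_Suc)
    ultimately show "p \<in> perm_of_list ` set rows_5" using perm_of_list_map[OF p] by (metis imageI)
  next
    fix p assume "p \<in> perm_of_list ` set rows_5"
    then obtain l where l: "l \<in> set rows_5" "p = perm_of_list l" by blast
    hence "distinct l" "set l = {1..5}" unfolding iv[symmetric] rows_5_def by auto
    hence "p permutes {1..5}" using perm_of_list_permutes l(2) by blast
    moreover have "p ` {1, 3, 5} = {1, 3, 5}" "p ` {2, 4} = {2, 4}"
      using l by (auto simp: rows_5_def perm_of_list_def)
    ultimately show "p \<in> row_group [[1, 3, 5], [2, 4]]"
      unfolding row_group_def iv by simp
  }
qed

text \<open>Both tableaux have the columns {1, 2} and {3, 4}; the third column of the larger one is
  the singleton {5}. Leaving A open and fixing all other points makes one computation serve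
  both.\<close>

lemma stabilizer_12_34:
  assumes "{1,2,3,4} \<subseteq> A"
  shows "{q. q permutes A \<and> q ` {1,2} = {1,2} \<and> q ` {3,4} = {3,4} \<and> (\<forall>i. i \<notin> {1,2,3,4} \<longrightarrow> q i = i)} =
    {id, transpose 1 2, transpose 3 4, transpose 1 2 \<circ> transpose 3 (4::nat)}" (is "?L = ?R")
proof
  have A: "1 \<in> A" "2 \<in> A" "3 \<in> A" "4 \<in> A" using assms by blast+
  hence "transpose 1 2 permutes A" "transpose 3 4 permutes A" by (blast intro: permutes_swap_id)+
  moreover from this have "transpose 1 2 \<circ> transpose 3 4 permutes A" by (rule permutes_compose[rotated])
  ultimately show "?R \<subseteq> ?L"
    by (simp add: permutes_id transpose_def insert_commute)
  show "?L \<subseteq> ?R"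
  proof
    fix q assume "q \<in> ?L"
    hence q: "q permutes A" "q ` {1,2} = {1,2}" "q ` {3,4} = {3,4}" "\<And>i. i \<notin> {1,2,3,4} \<Longrightarrow> q i = i"
      by blast+
    have eqI: "q = r" if "\<And>i. i \<notin> {1,2,3,4} \<Longrightarrow> r i = i" "q 1 = r 1" "q 2 = r 2" "q 3 = r 3" "q 4 = r 4" for r
    proof
      fix i show "q i = r i" using that q(4)[of i] by (cases "i \<in> {1,2,3,4}") auto
    qed
    have "q 1 \<in> {1,2}" "q 2 \<in> {1,2}" "q 3 \<in> {3,4}" "q 4 \<in> {3,4}"
      by (rule image_in[OF q(2)] image_in[OF q(3)], simp)+
    moreover have "q 1 \<noteq> q 2" "q 3 \<noteq> q 4" using permutes_inj[OF q(1)] by (simp_all add: inj_eq)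
    ultimately consider "q 1 = 1" "q 2 = 2" "q 3 = 3" "q 4 = 4" | "q 1 = 2" "q 2 = 1" "q 3 = 3" "q 4 = 4"
      | "q 1 = 1" "q 2 = 2" "q 3 = 4" "q 4 = 3" | "q 1 = 2" "q 2 = 1" "q 3 = 4" "q 4 = 3" by auto
    thus "q \<in> ?R"
    proof cases
      case 1 hence "q = id" by (intro eqI) auto
      thus ?thesis by blast
    next
      case 2 hence "q = transpose 1 2" by (intro eqI) (auto simp: transpose_def)
      thus ?thesis by blast
    next
      case 3 hence "q = transpose 3 4" by (intro eqI) (auto simp: transpose_def)
      thus ?thesis by blast
    next
      case 4 hence "q = transpose 1 2 \<circ> transpose 3 4" by (intro eqI) (auto simp: transpose_def)
      thus ?thesis by blast
    qed
  qed
qed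

lemma column_group_4:
  "column_group [[1, 3], [2, 4]] = {id, transpose 1 2, transpose 3 4, transpose 1 2 \<circ> transpose 3 4}"
proof -
  have c: "column [[1, 3], [2, 4]] j = (if j = 0 then {1,2} else if j = 1 then {3,4} else {})" for j
    unfolding column_conv_UN by (auto simp: lessThan_Suc nth_Cons')
  have A: "set (concat [[1, 3], [2, 4]]) = {1,2,3,4::nat}" by auto
  have iff: "(\<forall>j. q ` column [[1, 3], [2, 4]] j = column [[1, 3], [2, 4]] j) \<longleftrightarrow>
      q ` {1,2} = {1,2} \<and> q ` {3,4} = {3,4}" (is "?L \<longleftrightarrow> ?R") for q :: "nat \<Rightarrow> nat"
  proof
    assume L: ?L
    show ?R using L[rule_format, of 0] L[rule_format, of 1] unfolding c by simp
  next
    assume R: ?R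
    show ?L unfolding c using R by (metis (full_types) image_empty)
  qed
  have "column_group [[1, 3], [2, 4]] =
    {q. q permutes {1,2,3,4} \<and> q ` {1,2} = {1,2} \<and> q ` {3,4} = {3,4}}"
    by (simp only: column_group_def A iff)
  also have "\<dots> = {q. q permutes {1,2,3,4} \<and> q ` {1,2} = {1,2} \<and> q ` {3,4} = {3,4} \<and>
      (\<forall>i. i \<notin> {1,2,3,4} \<longrightarrow> q i = i)}"
  proof (rule Collect_cong)
    fix q :: "nat \<Rightarrow> nat"
    show "(q permutes {1,2,3,4} \<and> q ` {1,2} = {1,2} \<and> q ` {3,4} = {3,4}) =
      (q permutes {1,2,3,4} \<and> q ` {1,2} = {1,2} \<and> q ` {3,4} = {3,4} \<and>
        (\<forall>i. i \<notin> {1,2,3,4} \<longrightarrow> q i = i))"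
    proof (cases "q permutes {1,2,3,4}")
      case True
      hence N: "(\<forall>i. i \<notin> {1,2,3,4} \<longrightarrow> q i = i) = True" using permutes_not_in by metis
      show ?thesis by (simp only: N simp_thms)
    qed (simp only: simp_thms)
  qed
  also have "\<dots> = {id, transpose 1 2, transpose 3 4, transpose 1 2 \<circ> transpose 3 4}"
    by (rule stabilizer_12_34) simp
  finally show ?thesis .
qed

lemma column_group_5:
  "column_group [[1, 3, 5], [2, 4]] = {id, transpose 1 2, transpose 3 4, transpose 1 2 \<circ> transpose 3 4}"
proof -
  have c: "column [[1, 3, 5], [2, 4]] j =
      (if j = 0 then {1,2} else if j = 1 then {3,4} else if j = 2 then {5} else {})" for j
    unfolding column_conv_UN by (auto simp: lessThan_Suc nth_Cons')
  have A: "set (concat [[1, 3, 5], [2, 4]]) = {1,2,3,4,5::nat}" by auto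
  have iff: "(\<forall>j. q ` column [[1, 3, 5], [2, 4]] j = column [[1, 3, 5], [2, 4]] j) \<longleftrightarrow>
      q ` {1,2} = {1,2} \<and> q ` {3,4} = {3,4} \<and> q 5 = 5" (is "?L \<longleftrightarrow> ?R") for q :: "nat \<Rightarrow> nat"
  proof
    assume L: ?L
    show ?R using L[rule_format, of 0] L[rule_format, of 1] L[rule_format, of 2] unfolding c by simp
  next
    assume R: ?R
    hence "q ` {5} = {5}" by simp
    thus ?L unfolding c using R by (metis (full_types) image_empty)
  qed
  have "column_group [[1, 3, 5], [2, 4]] =
    {q. q permutes {1,2,3,4,5} \<and> q ` {1,2} = {1,2} \<and> q ` {3,4} = {3,4} \<and> q 5 = 5}"
    by (simp only: column_group_def A iff)
  also have "\<dots> = {q. q permutes {1,2,3,4,5} \<and> q ` {1,2} = {1,2} \<and> q ` {3,4} = {3,4} \<and>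
      (\<forall>i. i \<notin> {1,2,3,4} \<longrightarrow> q i = i)}"
  proof (intro Collect_cong)
    fix q :: "nat \<Rightarrow> nat"
    have "(\<forall>i. i \<notin> {1,2,3,4} \<longrightarrow> q i = i) \<longleftrightarrow> q 5 = 5" if "q permutes {1,2,3,4,5}"
    proof
      assume q5: "q 5 = 5"
      show "\<forall>i. i \<notin> {1,2,3,4} \<longrightarrow> q i = i"
      proof (intro allI impI)
        fix i :: nat assume "i \<notin> {1,2,3,4}"
        thus "q i = i" using permutes_not_in[OF that, of i] q5 by (cases "i = 5") simp_all
      qed
    qed simp
    thus "(q permutes {1,2,3,4,5} \<and> q ` {1,2} = {1,2} \<and> q ` {3,4} = {3,4} \<and> q 5 = 5) =
      (q permutes {1,2,3,4,5} \<and> q ` {1,2} = {1,2} \<and> q ` {3,4} = {3,4} \<and>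
        (\<forall>i. i \<notin> {1,2,3,4} \<longrightarrow> q i = i))"
      by (cases "q permutes {1,2,3,4,5}") (simp_all only: simp_thms)
  qed
  also have "\<dots> = {id, transpose 1 2, transpose 3 4, transpose 1 2 \<circ> transpose 3 4}"
    by (rule stabilizer_12_34) simp
  finally show ?thesis .
qed

text \<open>The four permutations are told apart by their values at 1 and 3, so the set sum has four
  separate terms.\<close>

lemma sum_signs_12_34:
  "(\<Sum>q\<in>{id, transpose 1 2, transpose 3 4, transpose 1 2 \<circ> transpose 3 (4::nat)}.
      of_int (sign q) * f q :: 'k::field) =
    f id - f (transpose 1 2) - f (transpose 3 4) + f (transpose 1 2 \<circ> transpose 3 4)"
proof -
  let ?a = "transpose 1 (2::nat)" and ?b = "transpose 3 (4::nat)"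
  have v: "id (1::nat) = 1" "?a 1 = 2" "?b 1 = 1" "(?a \<circ> ?b) 1 = 2"
    "id (3::nat) = 3" "?a 3 = 3" "?b 3 = 4" "(?a \<circ> ?b) 3 = 4"
    by (simp_all add: transpose_def)
  have ne: "id \<noteq> ?a" "id \<noteq> ?b" "id \<noteq> ?a \<circ> ?b" "?a \<noteq> ?b" "?a \<noteq> ?a \<circ> ?b" "?b \<noteq> ?a \<circ> ?b"
    using v by (metis numeral_eq_iff semiring_norm one_eq_numeral_iff)+
  have s: "sign (?a \<circ> ?b) = sign ?a * sign ?b" "sign ?a = -1" "sign ?b = -1"
    by (simp_all add: sign_compose permutation_swap_id sign_swap_id)
  show ?thesis using ne by (simp add: s del: One_nat_def)
qed

text \<open>A direct evaluation of 4 times 4 terms, valid for every \<open>H\<close> and hence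
  before any reduction. A single index is always in order; the conditional with equal branches only
  matches the common form with a factor \<sigma>.\<close>

lemma sum_table_w:
  fixes H :: "nat list \<Rightarrow> (nat \<Rightarrow> nat) \<Rightarrow> 'k::field"
  shows "(\<Sum>p | p permutes {1..4}. star (young_symmetrizer [[1, 3], [2, 4]]) p *
      ((if sorted (map p [4..<Suc 4]) then 1 else 1) *
       H (sorted_list_of_set (p ` {1..3})) (pattern3 p))) =
    (\<Sum>(D, \<kappa>)\<leftarrow>table_w. lform \<kappa> (H D))"
proof -
  have t: "set (concat [[1, 3], [2, 4]]) = {1..4::nat}" by auto
  have n: "3 \<le> (4::nat)" by simp
  have L: "distinct rows_4" "\<forall>l\<in>set rows_4. length l = 4" by (auto simp: rows_4_def)
  show ?thesis
    unfolding sum_star_young_contribution[OF t n row_group_4 L, of 1 H] column_group_4 sum_signs_12_34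
    by (simp add: rows_4_def contribution_def ranks_def transpose_def table_w_def lform_def algebra_simps
        numeral_2_eq_2[symmetric] numeral_3_eq_3[symmetric])
qed

lemma sum_table_S:
  fixes H :: "nat list \<Rightarrow> (nat \<Rightarrow> nat) \<Rightarrow> 'k::field"
  shows "(\<Sum>p | p permutes {1..5}. star (young_symmetrizer [[1, 3, 5], [2, 4]]) p *
      ((if sorted (map p [4..<Suc 5]) then 1 else 1) *
       H (sorted_list_of_set (p ` {1..3})) (pattern3 p))) =
    (\<Sum>(D, \<kappa>)\<leftarrow>table_S. lform \<kappa> (H D))"
proof -
  have t: "set (concat [[1, 3, 5], [2, 4]]) = {1..5::nat}" by auto
  have n: "3 \<le> (5::nat)" by simp
  have L: "distinct rows_5" "\<forall>l\<in>set rows_5. length l = 5" by (auto simp: rows_5_def)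
  show ?thesis
    unfolding sum_star_young_contribution[OF t n row_group_5 L, of 1 H] column_group_5 sum_signs_12_34
    by (simp add: rows_5_def contribution_def ranks_def transpose_def table_w_def table_S_def lform_def algebra_simps
        numeral_2_eq_2[symmetric] numeral_3_eq_3[symmetric])
qed

text \<open>With \<sigma> = -1 the 12 times 4 terms no longer cancel on the index sets {1, 2, 5} and
  {3, 4, 5}, so all ten index sets of U survive, against eight in the symmetric case.\<close>

lemma sum_table_A:
  fixes H :: "nat list \<Rightarrow> (nat \<Rightarrow> nat) \<Rightarrow> 'k::field"
  shows "(\<Sum>p | p permutes {1..5}. star (young_symmetrizer [[1, 3, 5], [2, 4]]) p *
      ((if sorted (map p [4..<Suc 5]) then 1 else -1) *
       H (sorted_list_of_set (p ` {1..3})) (pattern3 p))) =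
    (\<Sum>(D, \<kappa>)\<leftarrow>table_A. lform \<kappa> (H D))"
proof -
  have t: "set (concat [[1, 3, 5], [2, 4]]) = {1..5::nat}" by auto
  have n: "3 \<le> (5::nat)" by simp
  have L: "distinct rows_5" "\<forall>l\<in>set rows_5. length l = 5" by (auto simp: rows_5_def)
  show ?thesis
    unfolding sum_star_young_contribution[OF t n row_group_5 L, of "-1" H] column_group_5 sum_signs_12_34
    by (simp add: rows_5_def contribution_def ranks_def transpose_def table_w_def table_A_def lform_def algebra_simps
        numeral_2_eq_2[symmetric] numeral_3_eq_3[symmetric])
qed

section \<open>Lengths\<close>

lemma lform_scale: "lform \<kappa> (\<lambda>s. c * g s) = c * lform \<kappa> g"
  by (cases \<kappa>) (simp add: lform_def algebra_simps)

lemma lform_if: "lform \<kappa> (\<lambda>s. if b then g s else 0) = (if b then lform \<kappa> g else 0)"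
  by (cases \<kappa>) (simp add: lform_def)

lemma lform_cong:
  assumes "\<And>s. s permutes {1..3} \<Longrightarrow> f s = g s"
  shows "lform \<kappa> f = lform \<kappa> g"
proof -
  have "\<forall>s. s permutes {1..3} \<longrightarrow> f s = g s" using assms by blast
  thus ?thesis unfolding all_permutes_3 by (cases \<kappa>) (simp only: lform_def prod.case)
qed

text \<open>With pairwise different labels no two summands meet, so each nonzero one contributes its
  own point of the support.\<close>

lemma card_support_inj:
  assumes "finite A" "inj_on M A"
  shows "card {m. (\<Sum>a\<in>A. if M a = m then F a else (0::'k::comm_monoid_add)) \<noteq> 0} = card {a \<in> A. F a \<noteq> 0}"
proof -
  have at: "(\<Sum>a\<in>A. if M a = M b then F a else 0) = F b" if "b \<in> A" for b
  proof -
    have "(\<Sum>a\<in>A. if M a = M b then F a else 0) = (\<Sum>a\<in>A. if a = b then F a else 0)"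
      using assms(2) that by (intro sum.cong) (auto dest: inj_onD)
    thus ?thesis using assms(1) that by simp
  qed
  have off: "(\<Sum>a\<in>A. if M a = m then F a else 0) = 0" if "m \<notin> M ` A" for m
    using that by (intro sum.neutral) auto
  have "{m. (\<Sum>a\<in>A. if M a = m then F a else 0) \<noteq> 0} = M ` {a \<in> A. F a \<noteq> 0}"
  proof (intro equalityI subsetI)
    fix m assume "m \<in> {m. (\<Sum>a\<in>A. if M a = m then F a else 0) \<noteq> 0}"
    hence m: "(\<Sum>a\<in>A. if M a = m then F a else 0) \<noteq> 0" by simp
    then obtain b where "b \<in> A" "m = M b" using off by blast
    thus "m \<in> M ` {a \<in> A. F a \<noteq> 0}" using m at by auto
  qed (auto simp: at)
  thus ?thesis using assms(2) by (simp add: card_image inj_on_def)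
qed

definition monomial_of :: "nat \<Rightarrow> nat list \<Rightarrow> (nat \<Rightarrow> nat) \<Rightarrow> nat list \<times> nat list" where
  "monomial_of n D q = (map (\<lambda>k. D ! (q k - 1)) [1, 2, 3], sorted_list_of_set ({1..n} - set D))"

text \<open>The sorted indices of the second factor are the complement of those of U, so a monomial
  depends on p only through the index set of U.\<close>

lemma monomial_conv:
  assumes p: "p permutes {1..n}" and n: "n \<ge> 3"
  shows "monomial n p q = monomial_of n (sorted_list_of_set (p ` {1..3})) q"
proof -
  have s: "set (sorted_list_of_set (p ` {1..3})) = p ` {1..3}" by simp
  have "p ` {4..n} = p ` ({1..n} - {1..3})" using n by (intro arg_cong[of _ _ "(`) p"]) auto
  also have "\<dots> = p ` {1..n} - p ` {1..3}" using permutes_inj[OF p] by (rule image_set_diff)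
  also have "p ` {1..n} = {1..n}" by (rule permutes_image[OF p])
  finally have im: "set (map p [4..<Suc n]) = {1..n} - p ` {1..3}"
    by (simp add: atLeastLessThanSuc_atLeastAtMost del: upt_Suc)
  have "distinct (map p [4..<Suc n])"
    using inj_on_subset[OF permutes_inj[OF p]] by (simp add: distinct_map del: upt_Suc)
  hence "sorted_list_of_set (set (map p [4..<Suc n])) = sort (map p [4..<Suc n])"
    by (metis sorted_list_of_set_sort_remdups distinct_remdups_id)
  thus ?thesis unfolding monomial_def monomial_of_def im s by simp
qed

text \<open>The indices of U determine D as a set, hence as an increasing list; since D has no
  repetitions, their positions then determine q.\<close>

lemma monomial_of_inj:
  assumes D: "sorted_wrt (<) D" "length D = 3" and D': "sorted_wrt (<) D'" "length D' = 3"
    and q: "q permutes {1..3}" and q': "q' permutes {1..3}"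
    and eq: "monomial_of n D q = monomial_of n D' q'"
  shows "D = D'" "q = q'"
proof -
  have im: "set (map (\<lambda>k. D ! (q k - 1)) [1, 2, 3]) = set D"
    if "length D = 3" "q permutes {1..3}" for D :: "nat list" and q
  proof -
    have "length D = Suc (Suc (Suc 0))" using that(1) by simp
    then obtain a b c where "D = [a, b, c]" by (auto simp only: length_Suc_conv length_0_conv)
    hence "\<forall>q. q permutes {1..3} \<longrightarrow> set (map (\<lambda>k. D ! (q k - 1)) [1, 2, 3]) = set D"
      unfolding all_permutes_3 by auto
    thus ?thesis using that(2) by blast
  qed
  have m: "map (\<lambda>k. D ! (q k - 1)) [1, 2, 3] = map (\<lambda>k. D' ! (q' k - 1)) [1, 2, 3]"
    using eq unfolding monomial_of_def by simp
  hence "set D = set D'" using im[OF D(2) q] im[OF D'(2) q'] by simp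
  thus DD: "D = D'" using D(1) D'(1) by (metis strict_sorted_equal strict_sorted_iff)
  have d: "distinct D" using D(1) by (simp add: strict_sorted_iff)
  have "q k = q' k" if k: "k \<in> {1, 2, 3}" for k
  proof -
    have "k \<in> {1..3}" using k by auto
    \<comment> \<open>Both values are at least 1, so the subtraction of 1 does not truncate and can
      be undone.\<close>
    hence "q k \<in> {1..3}" "q' k \<in> {1..3}"
      by (simp_all only: permutes_in_image[OF q] permutes_in_image[OF q'])
    moreover have "D ! (q k - 1) = D ! (q' k - 1)" using m k DD by auto
    hence "q k - 1 = q' k - 1"
      using d D(2) calculation by (subst (asm) nth_eq_iff_index_eq) auto
    ultimately show ?thesis by auto
  qed
  moreover have "q k = q' k" if "k \<notin> {1, 2, 3}" for k
  proof -
    have "k \<notin> {1..3}" using that by auto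
    thus ?thesis using permutes_not_in[OF q] permutes_not_in[OF q'] by metis
  qed
  ultimately show "q = q'" by blast
qed

text \<open>The number N(q) of the overview. It refers to q alone, not to the partner in the
  pair.\<close>

definition monomial_count ::
  "'k::field \<Rightarrow> 'k \<Rightarrow> (nat list \<times> 'k \<times> 'k \<times> 'k) list \<Rightarrow> (nat \<Rightarrow> nat) \<Rightarrow> nat" where
  "monomial_count x y tab q = length (filter (\<lambda>e. lform (snd e) (\<lambda>s. rdet x y s q) \<noteq> 0) tab)"

text \<open>The common frame of the three cases. \<open>H\<close> is universally quantified because
  it is instantiated later with reduction coefficients restricted to one monomial.\<close>

locale reduction_table =
  fixes n :: nat and \<sigma> :: "'k::field" and c :: "'k group_ring_elt"
    and tab :: "(nat list \<times> 'k \<times> 'k \<times> 'k) list"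
  assumes n: "n \<ge> 3"
    and tab: "\<And>H. (\<Sum>p | p permutes {1..n}. c p *
      ((if sorted (map p [4..<Suc n]) then 1 else \<sigma>) *
       H (sorted_list_of_set (p ` {1..3})) (pattern3 p))) = (\<Sum>(D, \<kappa>)\<leftarrow>tab. lform \<kappa> (H D))"
    and distinct: "distinct (map fst tab)"
    and sorted: "\<And>e. e \<in> set tab \<Longrightarrow> sorted_wrt (<) (fst e) \<and> length (fst e) = 3"
begin

text \<open>By Cramer's rule the monomials belonging to p carry determinants against q w, and those
  belonging to q carry determinants against p w. The two counts appear exchanged, which their sum
  does not notice.\<close>

lemma card_reduced_polynomial:
  fixes scale :: "'k \<Rightarrow> 'v::ab_group_add \<Rightarrow> 'v"
  assumes V: "finite_dimensional_vector_space scale Basis"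
    and dim: "vector_space.dim scale (UNIV :: 'v set) \<ge> 3"
    and p: "p permutes {1..3}" and q: "q permutes {1..3}" and nz: "rdet x y p q \<noteq> 0"
  shows "card {m. reduced_polynomial scale n \<sigma> c (line_ideal x y) {p, q} m \<noteq> 0} =
    monomial_count x y tab p + monomial_count x y tab q"
proof -
  let ?red = "reduction_coeff scale (line_ideal x y) {p, q}"
  let ?M = "\<lambda>(r, e). monomial_of n (fst e) r"
  let ?F = "\<lambda>(r, e). lform (snd e) (\<lambda>s. ?red s r)"
  let ?A = "{p, q} \<times> set tab"
  have pq: "p \<noteq> q" using nz by auto
  have dt: "distinct tab" using distinct by (simp add: distinct_map)
  have perms: "r permutes {1..3}" if "r \<in> {p, q}" for r using that p q by blast
  have "inj_on ?M ?A"
  proof (rule inj_onI)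
    fix u v assume u: "u \<in> ?A" and v: "v \<in> ?A" and eq: "?M u = ?M v"
    obtain r e where u': "u = (r, e)" by (cases u)
    obtain r' e' where v': "v = (r', e')" by (cases v)
    have a: "r \<in> {p, q}" "r' \<in> {p, q}" "e \<in> set tab" "e' \<in> set tab" using u v u' v' by auto
    have "fst e = fst e'" "r = r'"
      using monomial_of_inj[OF _ _ _ _ perms[OF a(1)] perms[OF a(2)]] eq sorted[OF a(3)] sorted[OF a(4)]
      unfolding u' v' by auto
    moreover from this have "e = e'" using distinct a(3,4) by (metis distinct_map inj_onD)
    ultimately show "u = v" unfolding u' v' by simp
  qed
  have "reduced_polynomial scale n \<sigma> c (line_ideal x y) {p, q} m =
      (\<Sum>a\<in>?A. if ?M a = m then ?F a else 0)" for m
  proof -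
    have "reduced_polynomial scale n \<sigma> c (line_ideal x y) {p, q} m =
      (\<Sum>r\<in>{p, q}. \<Sum>s | s permutes {1..n}. if monomial n s r = m
       then c s * (if sorted (map s [4..<Suc n]) then 1 else \<sigma>) * ?red (pattern3 s) r else 0)"
      unfolding reduced_polynomial_def by (rule sum.swap)
    also have "\<dots> = (\<Sum>r\<in>{p, q}. \<Sum>s | s permutes {1..n}. c s *
      ((if sorted (map s [4..<Suc n]) then 1 else \<sigma>) *
       (if monomial_of n (sorted_list_of_set (s ` {1..3})) r = m then ?red (pattern3 s) r else 0)))"
      by (intro sum.cong refl) (simp add: monomial_conv[OF _ n] mult.assoc del: upt_Suc)
    also have "\<dots> = (\<Sum>r\<in>{p, q}. \<Sum>(D, \<kappa>)\<leftarrow>tab.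
        lform \<kappa> (\<lambda>s. if monomial_of n D r = m then ?red s r else 0))"
    proof (intro sum.cong refl)
      fix r
      show "(\<Sum>s | s permutes {1..n}. c s * ((if sorted (map s [4..<Suc n]) then 1 else \<sigma>) *
          (if monomial_of n (sorted_list_of_set (s ` {1..3})) r = m then ?red (pattern3 s) r else 0))) =
        (\<Sum>(D, \<kappa>)\<leftarrow>tab. lform \<kappa> (\<lambda>s. if monomial_of n D r = m then ?red s r else 0))"
        \<comment> \<open>With this \<open>H\<close> the universal expansion becomes the coefficient
          of the single monomial m.\<close>
        by (rule tab[of "\<lambda>D s. if monomial_of n D r = m then ?red s r else 0"])
    qed
    also have "\<dots> = (\<Sum>r\<in>{p, q}. \<Sum>e\<in>set tab. if ?M (r, e) = m then ?F (r, e) else 0)"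
      by (intro sum.cong refl)
        (simp add: lform_if sum.distinct_set_conv_list[OF dt] case_prod_unfold cong: if_cong)
    also have "\<dots> = (\<Sum>a\<in>?A. if ?M a = m then ?F a else 0)"
      by (simp add: sum.cartesian_product case_prod_unfold cong: if_cong)
    finally show ?thesis .
  qed
  hence "card {m. reduced_polynomial scale n \<sigma> c (line_ideal x y) {p, q} m \<noteq> 0} =
      card {a \<in> ?A. ?F a \<noteq> 0}"
    using card_support_inj[OF _ \<open>inj_on ?M ?A\<close>] by simp
  also have "{a \<in> ?A. ?F a \<noteq> 0} =
      Pair p ` {e \<in> set tab. ?F (p, e) \<noteq> 0} \<union> Pair q ` {e \<in> set tab. ?F (q, e) \<noteq> 0}" by auto
  also have "card \<dots> = card {e \<in> set tab. ?F (p, e) \<noteq> 0} + card {e \<in> set tab. ?F (q, e) \<noteq> 0}"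
    using pq by (subst card_Un_disjoint) (auto simp: card_image inj_on_def)
  finally have card: "card {m. reduced_polynomial scale n \<sigma> c (line_ideal x y) {p, q} m \<noteq> 0} =
    card {e \<in> set tab. ?F (p, e) \<noteq> 0} + card {e \<in> set tab. ?F (q, e) \<noteq> 0}" .
  have Fp: "?F (p, e) \<noteq> 0 \<longleftrightarrow> lform (snd e) (\<lambda>s. rdet x y s q) \<noteq> 0" for e
  proof -
    have "?F (p, e) = lform (snd e) (\<lambda>s. inverse (rdet x y p q) * rdet x y s q)"
      by (auto intro!: lform_cong
        simp: reduction_coeff_line_ideal[OF V dim p q nz] divide_inverse mult.commute simp del: One_nat_def)
    thus ?thesis using nz unfolding lform_scale by simp
  qed
  \<comment> \<open>Cramer's numerator is here the determinant of p w and s w; reversing its order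
    costs only a sign.\<close>
  have Fq: "?F (q, e) \<noteq> 0 \<longleftrightarrow> lform (snd e) (\<lambda>s. rdet x y s p) \<noteq> 0" for e
  proof -
    have "?F (q, e) = lform (snd e) (\<lambda>s. - inverse (rdet x y p q) * rdet x y s p)"
      by (auto intro!: lform_cong simp: reduction_coeff_line_ideal[OF V dim p q nz] divide_inverse
        rdet_swap[of x y p] mult.commute simp del: One_nat_def)
    thus ?thesis using nz unfolding lform_scale by simp
  qed
  have "card {e \<in> set tab. lform (snd e) (\<lambda>s. rdet x y s r) \<noteq> 0} = monomial_count x y tab r" for r
    unfolding monomial_count_def distinct_card[OF distinct_filter[OF dt], symmetric] set_filter ..
  thus ?thesis unfolding card Fp Fq by simp
qed

lemma reduced_length_eqI:
  fixes scale :: "'k \<Rightarrow> 'v::ab_group_add \<Rightarrow> 'v"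
  assumes V: "finite_dimensional_vector_space scale Basis"
    and dim: "vector_space.dim scale (UNIV :: 'v set) \<ge> 3"
    and pq: "p permutes {1..3}" "q permutes {1..3}" "rdet x y p q \<noteq> 0"
      "monomial_count x y tab p + monomial_count x y tab q = l"
    and min: "\<And>p q. p permutes {1..3} \<Longrightarrow> q permutes {1..3} \<Longrightarrow> rdet x y p q \<noteq> 0 \<Longrightarrow>
      l \<le> monomial_count x y tab p + monomial_count x y tab q"
  shows "reduced_length scale n \<sigma> c (line_ideal x y) = l"
  unfolding reduced_length_def
proof (rule Least_equality)
  show "\<exists>P. admissible (line_ideal x y) P \<and>
      l = card {m. reduced_polynomial scale n \<sigma> c (line_ideal x y) P m \<noteq> 0}"
    using pq card_reduced_polynomial[OF V dim pq(1-3)] unfolding admissible_line_ideal_iff by metis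
  fix k assume "\<exists>P. admissible (line_ideal x y) P \<and>
      k = card {m. reduced_polynomial scale n \<sigma> c (line_ideal x y) P m \<noteq> 0}"
  then obtain p q where "p permutes {1..3}" "q permutes {1..3}" "rdet x y p q \<noteq> 0"
    "k = card {m. reduced_polynomial scale n \<sigma> c (line_ideal x y) {p, q} m \<noteq> 0}"
    unfolding admissible_line_ideal_iff by blast
  thus "l \<le> k" using card_reduced_polynomial[OF V dim] min by metis
qed

end

interpretation table_w: reduction_table 4 1 "star (young_symmetrizer [[1, 3], [2, 4]])"
  "table_w :: (nat list \<times> 'k::field_char_0 \<times> 'k \<times> 'k) list"
  by (rule reduction_table.intro, simp, rule sum_table_w) (auto simp: table_w_def)

interpretation table_S: reduction_table 5 1 "star (young_symmetrizer [[1, 3, 5], [2, 4]])"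
  "table_S :: (nat list \<times> 'k::field_char_0 \<times> 'k \<times> 'k) list"
  by (rule reduction_table.intro, simp, rule sum_table_S) (auto simp: table_w_def table_S_def)

interpretation table_A: reduction_table 5 "-1" "star (young_symmetrizer [[1, 3, 5], [2, 4]])"
  "table_A :: (nat list \<times> 'k::field_char_0 \<times> 'k \<times> 'k) list"
  by (rule reduction_table.intro, simp, rule sum_table_A) (auto simp: table_w_def table_A_def)

section \<open>Vanishing of the determinants and the resulting counts\<close>

lemma lform_coeff:
  "lform (a, 0, 0) g = a * lform (1, 0, 0) g"
  "lform (0, b, 0) g = b * lform (0, 1, 0) g"
  "lform (0, 0, c) g = c * lform (0, 0, 1) g"
  by (simp_all add: lform_def)

lemma lform_minus [simp]:
  "lform (- a, 0, 0) g = - lform (a, 0, 0) g"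
  "lform (0, - b, 0) g = - lform (0, b, 0) g"
  "lform (0, 0, - c) g = - lform (0, 0, c) g"
  by (simp_all add: lform_coeff[of "- a"] lform_coeff[of a] lform_coeff(2)[of "- b"] lform_coeff(2)[of b]
      lform_coeff(3)[of "- c"] lform_coeff(3)[of c])

text \<open>\<open>table_w\<close> has two entries of each of the first two forms. The symmetric
  case adds four of the third form, the alternating case six more of the first, and a scalar factor
  such as -2 does not affect vanishing.\<close>

lemma monomial_count_tables:
  fixes x y :: "'k::field_char_0"
  defines "A \<equiv> \<lambda>q. lform (1, 0, 0) (\<lambda>s. rdet x y s q)"
    and "B \<equiv> \<lambda>q. lform (0, 1, 0) (\<lambda>s. rdet x y s q)"
    and "C \<equiv> \<lambda>q. lform (0, 0, 1) (\<lambda>s. rdet x y s q)"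
  shows "monomial_count x y table_w q = (if A q = 0 then 0 else 2) + (if B q = 0 then 0 else 2)"
    "monomial_count x y table_S q =
      (if A q = 0 then 0 else 2) + (if B q = 0 then 0 else 2) + (if C q = 0 then 0 else 4)"
    "monomial_count x y table_A q = (if A q = 0 then 0 else 8) + (if B q = 0 then 0 else 2)"
proof -
  have 2: "lform (2, 0, 0) (\<lambda>s. rdet x y s q) = 0 \<longleftrightarrow> A q = 0"
    unfolding A_def lform_coeff(1)[of 2] by simp
  show "monomial_count x y table_w q = (if A q = 0 then 0 else 2) + (if B q = 0 then 0 else 2)"
    "monomial_count x y table_S q =
      (if A q = 0 then 0 else 2) + (if B q = 0 then 0 else 2) + (if C q = 0 then 0 else 4)"
    "monomial_count x y table_A q = (if A q = 0 then 0 else 8) + (if B q = 0 then 0 else 2)"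
    using 2 by (simp_all add: monomial_count_def table_w_def table_S_def table_A_def A_def B_def C_def)
qed

text \<open>The forms are multiples of (-1, 1, 0), (0, -1, 1) and (1, 1, -2). Being parallel to them
  means, for q w, that its third coordinate is 0, that its first is 0, or that its first two agree.
  The six q run through the arrangements of x, 1, -x-1.\<close>

lemma lform_rdet_zero_iff:
  fixes x :: "'k::field_char_0"
  defines "Z \<equiv> \<lambda>\<kappa> l. lform \<kappa> (\<lambda>s. rdet x 1 s (perm_of_list l)) = 0"
  shows "Z (1, 0, 0) [1,2,3] \<longleftrightarrow> x = -1" "Z (1, 0, 0) [1,3,2] \<longleftrightarrow> False" "Z (1, 0, 0) [2,1,3] \<longleftrightarrow> x = -1"
    "Z (1, 0, 0) [2,3,1] \<longleftrightarrow> False" "Z (1, 0, 0) [3,1,2] \<longleftrightarrow> x = 0" "Z (1, 0, 0) [3,2,1] \<longleftrightarrow> x = 0"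
    "Z (0, 1, 0) [1,2,3] \<longleftrightarrow> x = 0" "Z (0, 1, 0) [1,3,2] \<longleftrightarrow> x = 0" "Z (0, 1, 0) [2,1,3] \<longleftrightarrow> False"
    "Z (0, 1, 0) [2,3,1] \<longleftrightarrow> x = -1" "Z (0, 1, 0) [3,1,2] \<longleftrightarrow> False" "Z (0, 1, 0) [3,2,1] \<longleftrightarrow> x = -1"
    "Z (0, 0, 1) [1,2,3] \<longleftrightarrow> x = 1" "Z (0, 0, 1) [1,3,2] \<longleftrightarrow> x = -1/2" "Z (0, 0, 1) [2,1,3] \<longleftrightarrow> x = 1"
    "Z (0, 0, 1) [2,3,1] \<longleftrightarrow> x = -1/2" "Z (0, 0, 1) [3,1,2] \<longleftrightarrow> x = -2" "Z (0, 0, 1) [3,2,1] \<longleftrightarrow> x = -2"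
proof -
  define L where "L \<kappa> l = lform \<kappa> (\<lambda>s. rdet x 1 s (perm_of_list l))" for \<kappa> l
  have v: "L (1, 0, 0) [1,2,3] = -3 * (x + 1)" "L (1, 0, 0) [1,3,2] = 3" "L (1, 0, 0) [2,1,3] = -3 * (x + 1)"
    "L (1, 0, 0) [2,3,1] = 3" "L (1, 0, 0) [3,1,2] = 3 * x" "L (1, 0, 0) [3,2,1] = 3 * x"
    "L (0, 1, 0) [1,2,3] = 3 * x" "L (0, 1, 0) [1,3,2] = 3 * x" "L (0, 1, 0) [2,1,3] = 3"
    "L (0, 1, 0) [2,3,1] = -3 * (x + 1)" "L (0, 1, 0) [3,1,2] = 3" "L (0, 1, 0) [3,2,1] = -3 * (x + 1)"
    "L (0, 0, 1) [1,2,3] = 1 - x" "L (0, 0, 1) [1,3,2] = - (2 * x + 1)" "L (0, 0, 1) [2,1,3] = x - 1"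
    "L (0, 0, 1) [2,3,1] = 2 * x + 1" "L (0, 0, 1) [3,1,2] = - (x + 2)" "L (0, 0, 1) [3,2,1] = x + 2"
    unfolding L_def lform_def rdet_def inv_perm_of_list_3 by (simp_all add: algebra_simps)
  have e: "x + 1 = 0 \<longleftrightarrow> x = -1" "x + 2 = 0 \<longleftrightarrow> x = -2" "2 * x + 1 = 0 \<longleftrightarrow> x = -1/2"
    "1 - x = 0 \<longleftrightarrow> x = 1" "x - 1 = 0 \<longleftrightarrow> x = 1"
    by (auto simp: eq_neg_iff_add_eq_0 field_simps)
  show "Z (1, 0, 0) [1,2,3] \<longleftrightarrow> x = -1" "Z (1, 0, 0) [1,3,2] \<longleftrightarrow> False" "Z (1, 0, 0) [2,1,3] \<longleftrightarrow> x = -1"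
    "Z (1, 0, 0) [2,3,1] \<longleftrightarrow> False" "Z (1, 0, 0) [3,1,2] \<longleftrightarrow> x = 0" "Z (1, 0, 0) [3,2,1] \<longleftrightarrow> x = 0"
    "Z (0, 1, 0) [1,2,3] \<longleftrightarrow> x = 0" "Z (0, 1, 0) [1,3,2] \<longleftrightarrow> x = 0" "Z (0, 1, 0) [2,1,3] \<longleftrightarrow> False"
    "Z (0, 1, 0) [2,3,1] \<longleftrightarrow> x = -1" "Z (0, 1, 0) [3,1,2] \<longleftrightarrow> False" "Z (0, 1, 0) [3,2,1] \<longleftrightarrow> x = -1"
    "Z (0, 0, 1) [1,2,3] \<longleftrightarrow> x = 1" "Z (0, 0, 1) [1,3,2] \<longleftrightarrow> x = -1/2" "Z (0, 0, 1) [2,1,3] \<longleftrightarrow> x = 1"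
    "Z (0, 0, 1) [2,3,1] \<longleftrightarrow> x = -1/2" "Z (0, 0, 1) [3,1,2] \<longleftrightarrow> x = -2" "Z (0, 0, 1) [3,2,1] \<longleftrightarrow> x = -2"
    unfolding Z_def L_def[symmetric] v mult_eq_0_iff neg_equal_0_iff_equal e by simp_all
qed

lemma perms_3:
  "perm_of_list [1,2,3] permutes {1..3}" "perm_of_list [1,3,2] permutes {1..3}"
  "perm_of_list [2,1,3] permutes {1..3}" "perm_of_list [2,3,1] permutes {1..3}"
  "perm_of_list [3,1,2] permutes {1..3}" "perm_of_list [3,2,1] permutes {1..3}"
  by simp_all

text \<open>Since a and b do not form an admissible pair, only one of them can occur in such a pair.\<close>

lemma (in reduction_table) reduced_length_eqI':
  fixes scale :: "'k \<Rightarrow> 'v::ab_group_add \<Rightarrow> 'v"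
  assumes V: "finite_dimensional_vector_space scale Basis"
    and dim: "vector_space.dim scale (UNIV :: 'v set) \<ge> 3"
    and pq: "p permutes {1..3}" "q permutes {1..3}" "rdet x y p q \<noteq> 0"
      "monomial_count x y tab p = k" "monomial_count x y tab q = k'" "k \<le> k'"
    and ab: "rdet x y a b = 0"
      "\<forall>s. s permutes {1..3} \<longrightarrow>
        (s = a \<or> s = b) \<and> k \<le> monomial_count x y tab s \<or> k' \<le> monomial_count x y tab s"
  shows "reduced_length scale n \<sigma> c (line_ideal x y) = k + k'"
proof (rule reduced_length_eqI[OF V dim pq(1-3)])
  show "monomial_count x y tab p + monomial_count x y tab q = k + k'" using pq by simp
  fix p q assume "p permutes {1..3}" "q permutes {1..3}" and nz: "rdet x y p q \<noteq> 0"
  hence b: "(s = a \<or> s = b) \<and> k \<le> monomial_count x y tab s \<or> k' \<le> monomial_count x y tab s"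
    if "s \<in> {p, q}" for s using ab(2) that by blast
  have "\<not> ((p = a \<or> p = b) \<and> (q = a \<or> q = b))"
    using nz ab(1) rdet_swap[of x y b a] by auto
  thus "k + k' \<le> monomial_count x y tab p + monomial_count x y tab q"
    using b[of p] b[of q] \<open>k \<le> k'\<close> by auto
qed

text \<open>The vectors w and (1 2) w have determinant (x - 1)(x + 1). At its zeros (2 3) replaces
  (1 2), with determinant -x (x + 2).\<close>

lemma exists_admissible_pair:
  fixes x :: "'k::field_char_0"
  obtains p q where "p permutes {1..3}" "q permutes {1..3}" "rdet x 1 p q \<noteq> 0"
proof (cases "x = 1 \<or> x = -1")
  case True
  have "rdet x 1 (perm_of_list [1,2,3]) (perm_of_list [1,3,2]) \<noteq> 0"
    using True unfolding rdet_def inv_perm_of_list_3 by auto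
  thus ?thesis using that perms_3(1,2) by blast
next
  case False
  have "rdet x 1 (perm_of_list [1,2,3]) (perm_of_list [2,1,3]) = (x - 1) * (x + 1)"
    unfolding rdet_def inv_perm_of_list_3 by (simp add: algebra_simps)
  also have "\<dots> \<noteq> 0" using False by (simp add: eq_neg_iff_add_eq_0)
  finally show ?thesis using that perms_3(1,3) by blast
qed

section \<open>The lengths as functions of the parameter\<close>

context
  fixes scale :: "'k::field_char_0 \<Rightarrow> 'v::ab_group_add \<Rightarrow> 'v" and Basis :: "'v set"
  assumes V: "finite_dimensional_vector_space scale Basis"
    and dim: "vector_space.dim scale (UNIV :: 'v set) \<ge> 3"
begin

lemma length_w_line_ideal:
  "length_w scale [[1, 3], [2, 4]] (line_ideal x 1) =
    (if x \<in> {0, -1} then 4 else 8)"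
proof -
  note eqI = table_w.reduced_length_eqI'[OF V dim, folded length_w_def]
  have c0: "length_w scale [[1, 3], [2, 4]] (line_ideal (0) (1::'k)) = 2 + 2"
  proof (rule eqI[OF perms_3(1) perms_3(5)])
    show "rdet (0) (1::'k) (perm_of_list [1,2,3]) (perm_of_list [3,1,2]) \<noteq> 0"
      unfolding rdet_def inv_perm_of_list_3 by simp
    \<comment> \<open>Here k = k', so no permutation lies below the bound k' and the exceptional
      pair may be the trivial one, a = b.\<close>
    show "rdet (0) (1::'k) (perm_of_list [1,2,3]) (perm_of_list [1,2,3]) = 0"
      unfolding rdet_def inv_perm_of_list_3 by simp
  qed (unfold all_permutes_3 monomial_count_tables lform_rdet_zero_iff, simp_all add: perm_of_list_inject)
  have c1: "length_w scale [[1, 3], [2, 4]] (line_ideal (-1) (1::'k)) = 2 + 2"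
  proof (rule eqI[OF perms_3(1) perms_3(4)])
    show "rdet (-1) (1::'k) (perm_of_list [1,2,3]) (perm_of_list [2,3,1]) \<noteq> 0"
      unfolding rdet_def inv_perm_of_list_3 by simp
    show "rdet (-1) (1::'k) (perm_of_list [1,2,3]) (perm_of_list [1,2,3]) = 0"
      unfolding rdet_def inv_perm_of_list_3 by simp
  qed (unfold all_permutes_3 monomial_count_tables lform_rdet_zero_iff, simp_all add: perm_of_list_inject)
  \<comment> \<open>Off the special values every table entry counts for every q, so all admissible
    pairs give the same length, twice the number of entries.\<close>
  have "length_w scale [[1, 3], [2, 4]] (line_ideal x 1) = 4 + 4" if x: "x \<notin> {0, -1}"
  proof -
    have c: "monomial_count x 1 table_w s = 4" if "s permutes {1..3}" for s
    proof -
      have "\<forall>s. s permutes {1..3} \<longrightarrow> monomial_count x 1 table_w s = 4"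
        unfolding all_permutes_3 monomial_count_tables lform_rdet_zero_iff using x by simp
      thus ?thesis using that by blast
    qed
    obtain p q where pq: "p permutes {1..3}" "q permutes {1..3}" "rdet x 1 p q \<noteq> 0"
      by (rule exists_admissible_pair)
    show ?thesis using eqI[OF pq c[OF pq(1)] c[OF pq(2)] order_refl rdet_self] c by simp
  qed
  thus ?thesis using c0 c1 by auto
qed

lemma length_S_line_ideal:
  "length_S scale [[1, 3, 5], [2, 4]] (line_ideal x 1) =
    (if x \<in> {0, -1, 1, -2, -1/2} then 12 else 16)"
proof -
  \<comment> \<open>Keeps the special values -1/2 and 1 apart; it amounts to 3 being
    nonzero.\<close>
  have half: "- (1/2) \<noteq> (1::'k)" by (simp add: field_simps)
  note eqI = table_S.reduced_length_eqI'[OF V dim, folded length_S_def]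
  have c0: "length_S scale [[1, 3, 5], [2, 4]] (line_ideal (0) (1::'k)) = 6 + 6"
  proof (rule eqI[OF perms_3(1) perms_3(5)])
    show "rdet (0) (1::'k) (perm_of_list [1,2,3]) (perm_of_list [3,1,2]) \<noteq> 0"
      unfolding rdet_def inv_perm_of_list_3 by simp
    show "rdet (0) (1::'k) (perm_of_list [1,2,3]) (perm_of_list [1,2,3]) = 0"
      unfolding rdet_def inv_perm_of_list_3 by simp
  qed (unfold all_permutes_3 monomial_count_tables lform_rdet_zero_iff, simp_all add: perm_of_list_inject half)
  have c1: "length_S scale [[1, 3, 5], [2, 4]] (line_ideal (-1) (1::'k)) = 6 + 6"
  proof (rule eqI[OF perms_3(1) perms_3(4)])
    show "rdet (-1) (1::'k) (perm_of_list [1,2,3]) (perm_of_list [2,3,1]) \<noteq> 0"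
      unfolding rdet_def inv_perm_of_list_3 by simp
    show "rdet (-1) (1::'k) (perm_of_list [1,2,3]) (perm_of_list [1,2,3]) = 0"
      unfolding rdet_def inv_perm_of_list_3 by simp
  qed (unfold all_permutes_3 monomial_count_tables lform_rdet_zero_iff, simp_all add: perm_of_list_inject half)
  \<comment> \<open>The vector (1, 1, -2) is fixed by (1 2), so the two permutations with count 4
    give the same vector and only one of them fits into a pair. The cases -2 and -1/2 behave alike,
    with (2 3) and (1 3).\<close>
  have c2: "length_S scale [[1, 3, 5], [2, 4]] (line_ideal (1) (1::'k)) = 4 + 8"
  proof (rule eqI[OF perms_3(1) perms_3(2)])
    show "rdet (1) (1::'k) (perm_of_list [1,2,3]) (perm_of_list [1,3,2]) \<noteq> 0"
      unfolding rdet_def inv_perm_of_list_3 by simp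
    show "rdet (1) (1::'k) (perm_of_list [1,2,3]) (perm_of_list [2,1,3]) = 0"
      unfolding rdet_def inv_perm_of_list_3 by simp
  qed (unfold all_permutes_3 monomial_count_tables lform_rdet_zero_iff, simp_all add: perm_of_list_inject half)
  have c3: "length_S scale [[1, 3, 5], [2, 4]] (line_ideal (-2) (1::'k)) = 4 + 8"
  proof (rule eqI[OF perms_3(6) perms_3(1)])
    show "rdet (-2) (1::'k) (perm_of_list [3,2,1]) (perm_of_list [1,2,3]) \<noteq> 0"
      unfolding rdet_def inv_perm_of_list_3 by simp
    show "rdet (-2) (1::'k) (perm_of_list [3,1,2]) (perm_of_list [3,2,1]) = 0"
      unfolding rdet_def inv_perm_of_list_3 by simp
  qed (unfold all_permutes_3 monomial_count_tables lform_rdet_zero_iff, simp_all add: perm_of_list_inject half)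
  have c4: "length_S scale [[1, 3, 5], [2, 4]] (line_ideal (-1/2) (1::'k)) = 4 + 8"
  proof (rule eqI[OF perms_3(2) perms_3(1)])
    show "rdet (-1/2) (1::'k) (perm_of_list [1,3,2]) (perm_of_list [1,2,3]) \<noteq> 0"
      unfolding rdet_def inv_perm_of_list_3 by simp
    show "rdet (-1/2) (1::'k) (perm_of_list [1,3,2]) (perm_of_list [2,3,1]) = 0"
      unfolding rdet_def inv_perm_of_list_3 by simp
  qed (unfold all_permutes_3 monomial_count_tables lform_rdet_zero_iff, simp_all add: perm_of_list_inject half)
  have "length_S scale [[1, 3, 5], [2, 4]] (line_ideal x 1) = 8 + 8" if x: "x \<notin> {0, -1, 1, -2, -1/2}"
  proof -
    have c: "monomial_count x 1 table_S s = 8" if "s permutes {1..3}" for s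
    proof -
      have "\<forall>s. s permutes {1..3} \<longrightarrow> monomial_count x 1 table_S s = 8"
        unfolding all_permutes_3 monomial_count_tables lform_rdet_zero_iff using x by simp
      thus ?thesis using that by blast
    qed
    obtain p q where pq: "p permutes {1..3}" "q permutes {1..3}" "rdet x 1 p q \<noteq> 0"
      by (rule exists_admissible_pair)
    show ?thesis using eqI[OF pq c[OF pq(1)] c[OF pq(2)] order_refl rdet_self] c by simp
  qed
  thus ?thesis using c0 c1 c2 c3 c4 by auto
qed

lemma length_A_line_ideal:
  "length_A scale [[1, 3, 5], [2, 4]] (line_ideal x 1) =
    (if x \<in> {0, -1} then 10 else 20)"
proof -
  note eqI = table_A.reduced_length_eqI'[OF V dim, folded length_A_def]
  \<comment> \<open>Two permutations have count 2, but they send w = (0, 1, -1) to (1, -1, 0) and to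
    its negative; the partner must then come from those with count at least 8. At x = -1 the same
    happens.\<close>
  have c0: "length_A scale [[1, 3, 5], [2, 4]] (line_ideal (0) (1::'k)) = 2 + 8"
  proof (rule eqI[OF perms_3(5) perms_3(1)])
    show "rdet (0) (1::'k) (perm_of_list [3,1,2]) (perm_of_list [1,2,3]) \<noteq> 0"
      unfolding rdet_def inv_perm_of_list_3 by simp
    show "rdet (0) (1::'k) (perm_of_list [3,1,2]) (perm_of_list [3,2,1]) = 0"
      unfolding rdet_def inv_perm_of_list_3 by simp
  qed (unfold all_permutes_3 monomial_count_tables lform_rdet_zero_iff, simp_all add: perm_of_list_inject)
  have c1: "length_A scale [[1, 3, 5], [2, 4]] (line_ideal (-1) (1::'k)) = 2 + 8"
  proof (rule eqI[OF perms_3(1) perms_3(4)])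
    show "rdet (-1) (1::'k) (perm_of_list [1,2,3]) (perm_of_list [2,3,1]) \<noteq> 0"
      unfolding rdet_def inv_perm_of_list_3 by simp
    show "rdet (-1) (1::'k) (perm_of_list [1,2,3]) (perm_of_list [2,1,3]) = 0"
      unfolding rdet_def inv_perm_of_list_3 by simp
  qed (unfold all_permutes_3 monomial_count_tables lform_rdet_zero_iff, simp_all add: perm_of_list_inject)
  have "length_A scale [[1, 3, 5], [2, 4]] (line_ideal x 1) = 10 + 10" if x: "x \<notin> {0, -1}"
  proof -
    have c: "monomial_count x 1 table_A s = 10" if "s permutes {1..3}" for s
    proof -
      have "\<forall>s. s permutes {1..3} \<longrightarrow> monomial_count x 1 table_A s = 10"
        unfolding all_permutes_3 monomial_count_tables lform_rdet_zero_iff using x by simp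
      thus ?thesis using that by blast
    qed
    obtain p q where pq: "p permutes {1..3}" "q permutes {1..3}" "rdet x 1 p q \<noteq> 0"
      by (rule exists_admissible_pair)
    show ?thesis using eqI[OF pq c[OF pq(1)] c[OF pq(2)] order_refl rdet_self] c by simp
  qed
  thus ?thesis using c0 c1 by auto
qed

end

text \<open>(0, 1, -1) and (-1, 1, 0) are negated by (2 3) and (1 2). In (1, 1, -2), (-2, 1, 1) and
  (-1/2, 1, -1/2) two coordinates agree, so the transposition of these places fixes them. Thus
  \<epsilon> is 1 or -1, and m = 2 serves always.\<close>

lemma index_commutation_symmetry_line_ideal:
  fixes x :: "'k::field_char_0" and scale :: "'k \<Rightarrow> 'v::ab_group_add \<Rightarrow> 'v"
  assumes "x \<in> {0, -1, 1, -2, -1/2}"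
  shows "index_commutation_symmetry scale (line_ideal x 1)"
proof -
  have I: "index_commutation_symmetry scale (line_ideal x 1)"
    if "perm_of_list l permutes {1..3}" "perm_of_list l \<noteq> perm_of_list [1,2,3]" "\<epsilon> = 1 \<or> \<epsilon> = -1"
      "wvec x 1 (inv (perm_of_list l) 1) = \<epsilon> * x" "wvec x 1 (inv (perm_of_list l) 2) = \<epsilon>" for l \<epsilon>
    using that perm_of_list_3_eqs(1)
    by (intro index_commutation_symmetryI[of "perm_of_list l" 2 \<epsilon>]) auto
  consider "x = 0" | "x = -1" | "x = 1" | "x = -2" | "x = -1/2" using assms by blast
  thus ?thesis
  proof cases
    case 1 show ?thesis
      by (rule I[OF perms_3(2), of "-1"]) (unfold inv_perm_of_list_3, simp_all add: perm_of_list_inject 1)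
  next
    case 2 show ?thesis
      by (rule I[OF perms_3(3), of "-1"]) (unfold inv_perm_of_list_3, simp_all add: perm_of_list_inject 2)
  next
    case 3 show ?thesis
      by (rule I[OF perms_3(3), of 1]) (unfold inv_perm_of_list_3, simp_all add: perm_of_list_inject 3)
  next
    case 4 show ?thesis
      by (rule I[OF perms_3(2), of 1]) (unfold inv_perm_of_list_3, simp_all add: perm_of_list_inject 4)
  next
    case 5 show ?thesis
      by (rule I[OF perms_3(6), of 1]) (unfold inv_perm_of_list_3, simp_all add: perm_of_list_inject 5)
  qed
qed

theorem theorem1p8:
  fixes scale :: "'k::field_char_0 \<Rightarrow> 'v::ab_group_add \<Rightarrow> 'v"
    and Basis :: "'v set"
    and t t' :: "nat list list"
    and R :: "'k group_ring_elt set set"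
  assumes K: "(\<exists>\<phi> :: 'k \<Rightarrow> real. field_iso \<phi>) \<or> (\<exists>\<phi> :: 'k \<Rightarrow> complex. field_iso \<phi>)"
    and V: "finite_dimensional_vector_space scale Basis"
    and dimV: "vector_space.dim scale (UNIV :: 'v set) \<ge> 3"
    and t: "t = [[1, 3], [2, 4]]"
    and t': "t' = [[1, 3, 5], [2, 4]]"
    and R: "R = {J. minimal_right_ideal 3 J \<and> belongs_to_partition [2, 1] J \<and>
                    J \<noteq> principal_right_ideal 3 f0}"
  shows
    "finite {J \<in> R. \<not> (length_w scale t J = 8 \<and> length_S scale t' J = 16 \<and> length_A scale t' J = 20)} \<and>
     ((\<exists>J\<in>R. length_w scale t J = 4) \<and> (\<forall>J\<in>R. 4 \<le> length_w scale t J)) \<and>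
     ((\<exists>J\<in>R. length_S scale t' J = 12) \<and> (\<forall>J\<in>R. 12 \<le> length_S scale t' J)) \<and>
     ((\<exists>J\<in>R. length_A scale t' J = 10) \<and> (\<forall>J\<in>R. 10 \<le> length_A scale t' J)) \<and>
     card {J \<in> R. length_w scale t J = 4 \<and> length_S scale t' J = 12 \<and> length_A scale t' J = 10} = 2 \<and>
     (\<forall>J\<in>R. length_w scale t J = 4 \<or> length_S scale t' J = 12 \<or> length_A scale t' J = 10
        \<longrightarrow> index_commutation_symmetry scale J)"
proof -
  note w = length_w_line_ideal[OF V dimV] and S = length_S_line_ideal[OF V dimV]
    and A = length_A_line_ideal[OF V dimV]
  have R: "R = range (\<lambda>x. line_ideal x 1)" unfolding R by (rule ideals_of_partition_21)
  have "{J \<in> R. \<not> (length_w scale t J = 8 \<and> length_S scale t' J = 16 \<and> length_A scale t' J = 20)}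
      \<subseteq> (\<lambda>x. line_ideal x 1) ` {0, -1, 1, -2, -1/2}"
  proof (rule subsetI)
    fix J
    assume "J \<in> {J \<in> R. \<not> (length_w scale t J = 8 \<and> length_S scale t' J = 16 \<and> length_A scale t' J = 20)}"
    then obtain x where J: "J = line_ideal x 1" and n: "\<not> (length_w scale t (line_ideal x 1) = 8 \<and>
        length_S scale t' (line_ideal x 1) = 16 \<and> length_A scale t' (line_ideal x 1) = 20)"
      unfolding R by blast
    have "x \<in> {0, -1, 1, -2, -1/2}"
      using n unfolding t t' w S A by (simp split: if_splits)
    thus "J \<in> (\<lambda>x. line_ideal x 1) ` {0, -1, 1, -2, -1/2}" unfolding J by (rule imageI)
  qed
  hence 1: "finite {J \<in> R. \<not> (length_w scale t J = 8 \<and> length_S scale t' J = 16 \<and> length_A scale t' J = 20)}"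
    by (rule finite_subset) simp
  have 2: "\<forall>J\<in>R. 4 \<le> length_w scale t J" "\<forall>J\<in>R. 12 \<le> length_S scale t' J"
    "\<forall>J\<in>R. 10 \<le> length_A scale t' J"
    unfolding R t t' ball_simps w S A by simp_all
  have J0: "line_ideal 0 1 \<in> R" unfolding R by blast
  have 3: "length_w scale t (line_ideal 0 1) = 4" "length_S scale t' (line_ideal 0 1) = 12"
    "length_A scale t' (line_ideal 0 1) = 10"
    unfolding t t' w S A by simp_all
  \<comment> \<open>The special values for w and for A are the same two, and both occur among the
    five for S.\<close>
  have iff: "length_w scale t (line_ideal x 1) = 4 \<and> length_S scale t' (line_ideal x 1) = 12 \<and>
      length_A scale t' (line_ideal x 1) = 10 \<longleftrightarrow> x \<in> {0, -1}" for x
    unfolding t t' w S A by auto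
  \<comment> \<open>Moves the condition from ideals to parameters, so that injectivity of the
    parametrization yields the cardinality.\<close>
  have "{J \<in> range f. P J} = f ` {x. P (f x)}" for f :: "'k \<Rightarrow> 'k group_ring_elt set" and P
    by blast
  hence "{J \<in> R. length_w scale t J = 4 \<and> length_S scale t' J = 12 \<and> length_A scale t' J = 10} =
      (\<lambda>x. line_ideal x 1) ` {0, -1}"
    unfolding R by (simp only: iff Collect_mem_eq)
  moreover have "card ((\<lambda>x. line_ideal x 1) ` {0, -1 :: 'k}) = card {0, -1 :: 'k}"
    by (rule card_image) (simp add: inj_on_def line_ideal_eq_iff)
  ultimately have 4: "card {J \<in> R. length_w scale t J = 4 \<and> length_S scale t' J = 12 \<and> length_A scale t' J = 10} = 2"
    by simp
  have 5: "\<forall>J\<in>R. length_w scale t J = 4 \<or> length_S scale t' J = 12 \<or> length_A scale t' J = 10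
        \<longrightarrow> index_commutation_symmetry scale J"
  proof (intro ballI impI)
    fix J assume "J \<in> R" and m: "length_w scale t J = 4 \<or> length_S scale t' J = 12 \<or> length_A scale t' J = 10"
    then obtain x where J: "J = line_ideal x 1" unfolding R by blast
    have "x \<in> {0, -1, 1, -2, -1/2}"
      using m unfolding J t t' w S A by (simp split: if_splits) auto
    thus "index_commutation_symmetry scale J" unfolding J by (rule index_commutation_symmetry_line_ideal)
  qed
  show ?thesis using 1 2 3 4 5 J0 by blast
qed

end
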